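(* There is an $O(\mathrm{MIS}(n,\Delta)/\epsilon)$-round algorithm in the CONGEST model that finds a $(1+\epsilon)\Delta$-approximation for maximum-weight independent set. Whether the algorithm is deterministic or randomized depends on the maximal-independent-set algorithm that is run as a black box.
   Context: CONGEST model: the input graph is a synchronous communication network of $n$ computationally unbounded nodes, each with a unique $O(\log n)$-bit identifier; in each round each node may send a message of $O(\log n)$ bits to each of its neighbors. The nodes have no global information (in particular they do not know $n$ or $\Delta$); before the algorithm starts each node knows its own identifier and some polynomial upper bound on $n$. Complexity is the number of rounds. The input is a node-weighted graph $G_w=(V,E,w)$ with node-weight function $w:V\to\mathbb{R}$, $n$ nodes and maximum degree $\Delta$; the maximum weight of a node can be as high as $\mathrm{poly}(n)$. For $U\subseteq V$, $w(U)=\sum_{v\in U}w(v)$. A maximum-weight independent set is an independent set of maximum total weight, and an independent set $I$ is an $r$-approximation if $r\cdot w(I)\ge \max\{w(J): J\subseteq V \text{ independent}\}$. A maximal independent set is an inclusion-maximal independent set. $\mathrm{MIS}(n,\Delta)$ denotes the running time of finding a maximal independent set in the CONGEST model in graphs with $n$ nodes and maximum degree $\Delta$; the algorithm uses a maximal-independent-set algorithm with this running time as a black box. $\epsilon>0$ is the approximation parameter.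
   Formalization: Weights are reals of size at most poly(n) with a common denominator at most poly(n) (arbitrary reals cannot be compared with O(log n)-bit messages); Δ ≥ 1 and MIS(n,Δ) ≥ 1 are assumed; the round bound is O(MIS(n,Δ)·max(1,1/ε)), as for large ε the literal bound drops below one round. *)

theory Defs
  imports "HOL-Probability.Probability"
begin

section \<open>Graphs and independent sets\<close>

text \<open>Nodes are natural numbers: a node is identified with its unique identifier.\<close>

definition simple_graph :: "nat set \<Rightarrow> nat set set \<Rightarrow> bool" where
  "simple_graph V E \<longleftrightarrow> finite V \<and> V \<noteq> {} \<and> (\<forall>e\<in>E. e \<subseteq> V \<and> card e = 2)"

definition neighbours :: "nat set set \<Rightarrow> nat \<Rightarrow> nat set" where
  "neighbours E v = {u. {u, v} \<in> E}"

definition max_degree :: "nat set \<Rightarrow> nat set set \<Rightarrow> nat" where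
  "max_degree V E = Max ((\<lambda>v. card (neighbours E v)) ` V)"

definition independent_set :: "nat set \<Rightarrow> nat set set \<Rightarrow> nat set \<Rightarrow> bool" where
  "independent_set V E I \<longleftrightarrow> I \<subseteq> V \<and> (\<forall>u\<in>I. \<forall>v\<in>I. {u, v} \<notin> E)"

definition maximal_independent_set :: "nat set \<Rightarrow> nat set set \<Rightarrow> nat set \<Rightarrow> bool" where
  "maximal_independent_set V E I \<longleftrightarrow>
     independent_set V E I \<and> (\<forall>J. independent_set V E J \<and> I \<subseteq> J \<longrightarrow> J = I)"

definition approximates_MWIS ::
    "nat set \<Rightarrow> nat set set \<Rightarrow> (nat \<Rightarrow> real) \<Rightarrow> real \<Rightarrow> nat set \<Rightarrow> bool" where
  "approximates_MWIS V E w c I \<longleftrightarrow>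
     independent_set V E I \<and> c * sum w I \<ge> Max (sum w ` {J. independent_set V E J})"


section \<open>The CONGEST model\<close>

text \<open>
  A node addresses its neighbours through ports \<open>0, \<dots>, deg - 1\<close>; port \<open>i\<close> of node \<open>v\<close> leads
  to \<open>P v ! i\<close>.  The node sees its ports but not the identifiers at their other ends.
\<close>

definition port_numbering :: "nat set \<Rightarrow> nat set set \<Rightarrow> (nat \<Rightarrow> nat list) \<Rightarrow> bool" where
  "port_numbering V E P \<longleftrightarrow> (\<forall>v\<in>V. distinct (P v) \<and> set (P v) = neighbours E v)"

definition port_to :: "(nat \<Rightarrow> nat list) \<Rightarrow> nat \<Rightarrow> nat \<Rightarrow> nat" where
  "port_to P u v = (LEAST i. i < length (P u) \<and> P u ! i = v)"

text \<open>
  Nodes are computationally unbounded, so instead of an explicit local state an algorithm acts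
  on the complete local history of the node: its initial knowledge, the random seeds it has drawn
  (one at the start, one after each round) and the messages received in each round (one bit
  string per port, in port order).
\<close>

record view =
  ident :: nat
  bound :: nat
  weight :: real
  degree :: nat
  seeds :: "nat list"
  inboxes :: "bool list list list"

text \<open>
  \<open>rnd\<close> is the distribution of a single private random seed, \<open>send\<close> gives the message for a
  port, and \<open>result\<close> is \<open>None\<close> until the node halts with the decision whether it joins the
  computed set.
\<close>

record algo =
  rnd :: "nat pmf"
  send :: "view \<Rightarrow> nat \<Rightarrow> bool list"
  result :: "view \<Rightarrow> bool option"

definition deterministic :: "algo \<Rightarrow> bool" where
  "deterministic A \<longleftrightarrow> (\<exists>s. rnd A = return_pmf s)"

text \<open>A halted node is silent; silence is the empty bit string.\<close>

definition sent :: "algo \<Rightarrow> view \<Rightarrow> nat \<Rightarrow> bool list" where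
  "sent A K i = (if result A K = None then send A K i else [])"

text \<open>
  The view of node \<open>v\<close> after \<open>r\<close> synchronous rounds, where \<open>N\<close> is the known upper bound on the
  number of nodes and \<open>\<omega> (v, k)\<close> is the \<open>k\<close>-th seed of \<open>v\<close>.  The view of a halted node is
  frozen, hence outputs are irrevocable.
\<close>

primrec view_at :: "algo \<Rightarrow> (nat \<Rightarrow> nat list) \<Rightarrow> nat \<Rightarrow> (nat \<Rightarrow> real) \<Rightarrow> (nat \<times> nat \<Rightarrow> nat) \<Rightarrow>
    nat \<Rightarrow> nat \<Rightarrow> view" where
  "view_at A P N w \<omega> 0 v =
     \<lparr>ident = v, bound = N, weight = w v, degree = length (P v), seeds = [\<omega> (v, 0)], inboxes = []\<rparr>"
| "view_at A P N w \<omega> (Suc r) v =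
     (let K = view_at A P N w \<omega> r v in
      if result A K \<noteq> None then K
      else K\<lparr>seeds := seeds K @ [\<omega> (v, Suc r)],
             inboxes := inboxes K @
               [map (\<lambda>u. sent A (view_at A P N w \<omega> r u) (port_to P u v)) (P v)]\<rparr>)"

text \<open>
  All nodes have halted within \<open>r\<close> rounds, and the set they have computed satisfies \<open>Q\<close>.
\<close>

definition finishes :: "algo \<Rightarrow> nat set \<Rightarrow> (nat \<Rightarrow> nat list) \<Rightarrow> nat \<Rightarrow> (nat \<Rightarrow> real) \<Rightarrow>
    nat \<Rightarrow> (nat set \<Rightarrow> bool) \<Rightarrow> (nat \<times> nat \<Rightarrow> nat) \<Rightarrow> bool" where
  "finishes A V P N w r Q \<omega> \<longleftrightarrow>
     (\<forall>v\<in>V. result A (view_at A P N w \<omega> r v) \<noteq> None) \<and>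
     Q {v\<in>V. result A (view_at A P N w \<omega> r v) = Some True}"

text \<open>
  The seeds drawn within \<open>r\<close> rounds are independent; only these influence the event below.
\<close>

definition success_prob :: "algo \<Rightarrow> nat set \<Rightarrow> (nat \<Rightarrow> nat list) \<Rightarrow> nat \<Rightarrow> (nat \<Rightarrow> real) \<Rightarrow>
    nat \<Rightarrow> (nat set \<Rightarrow> bool) \<Rightarrow> real" where
  "success_prob A V P N w r Q =
     measure_pmf.prob (Pi_pmf (V \<times> {..r}) 0 (\<lambda>_. rnd A)) {\<omega>. finishes A V P N w r Q \<omega>}"

text \<open>In every execution, every message has at most \<open>\<beta> log n\<close> bits.\<close>

definition bandwidth :: "algo \<Rightarrow> nat set \<Rightarrow> (nat \<Rightarrow> nat list) \<Rightarrow> nat \<Rightarrow> (nat \<Rightarrow> real) \<Rightarrow>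
    real \<Rightarrow> bool" where
  "bandwidth A V P N w \<beta> \<longleftrightarrow>
     (\<forall>\<omega> r. (\<forall>x. \<omega> x \<in> set_pmf (rnd A)) \<longrightarrow>
       (\<forall>v\<in>V. \<forall>i<length (P v).
          real (length (sent A (view_at A P N w \<omega> r v) i)) \<le> \<beta> * log 2 (card V)))"

text \<open>
  Identifiers have \<open>O(log n)\<close> bits, and \<open>N\<close> is a polynomial upper bound on \<open>n\<close>; the exponents
  \<open>a\<close> and \<open>b\<close> are the hidden constants.
\<close>

definition congest_network :: "nat \<Rightarrow> nat \<Rightarrow> nat set \<Rightarrow> nat set set \<Rightarrow> (nat \<Rightarrow> nat list) \<Rightarrow>
    nat \<Rightarrow> bool" where
  "congest_network a b V E P N \<longleftrightarrow>
     simple_graph V E \<and> port_numbering V E P \<and>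
     (\<forall>v\<in>V. v \<le> card V ^ a) \<and> card V \<le> N \<and> N \<le> card V ^ b"

text \<open>
  Node weights are real numbers (of either sign) of magnitude at most \<open>poly(n)\<close> that fit into
  \<open>O(log n)\<close>-bit messages: they have a common denominator \<open>D\<close>, not known to the nodes, that is
  at most \<open>poly(n)\<close>.  Integral weights are the case \<open>D = 1\<close>.
\<close>

definition poly_weights :: "nat \<Rightarrow> nat set \<Rightarrow> (nat \<Rightarrow> real) \<Rightarrow> bool" where
  "poly_weights d V w \<longleftrightarrow>
     (\<exists>D::nat. 1 \<le> D \<and> D \<le> card V ^ d \<and>
        (\<forall>v\<in>V. \<bar>w v\<bar> \<le> real (card V) ^ d \<and> w v * real D \<in> \<int>))"

text \<open>
  \<open>A\<close> finds a maximal independent set in every graph with \<open>n\<close> nodes and maximum degree at most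
  \<open>\<Delta>\<close> within \<open>T n \<Delta>\<close> rounds, except with probability \<open>p n\<close>.  There are no weights in this
  problem, so every node gets the dummy weight \<open>0\<close>.
\<close>

definition MIS_algorithm :: "nat \<Rightarrow> nat \<Rightarrow> real \<Rightarrow> (nat \<Rightarrow> nat \<Rightarrow> nat) \<Rightarrow> (nat \<Rightarrow> real) \<Rightarrow>
    algo \<Rightarrow> bool" where
  "MIS_algorithm a b \<beta> T p A \<longleftrightarrow>
     (\<forall>V E P N. congest_network a b V E P N \<longrightarrow>
        bandwidth A V P N (\<lambda>_. 0) \<beta> \<and>
        (\<forall>\<Delta>\<ge>max_degree V E.
           success_prob A V P N (\<lambda>_. 0) (T (card V) \<Delta>) (maximal_independent_set V E)
             \<ge> 1 - p (card V)))"

text \<open>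
  \<open>B\<close> finds an \<open>f \<Delta>\<close>-approximation for maximum-weight independent set within \<open>R n \<Delta>\<close> rounds,
  except with probability \<open>q n\<close>, in every graph with \<open>n\<close> nodes and maximum degree \<open>\<Delta> \<ge> 1\<close>.
  (For \<open>\<Delta> = 0\<close> the factor \<open>(1 + \<epsilon>) \<Delta>\<close> is \<open>0\<close>, which no set attains if some weight is positive.)
\<close>

definition MWIS_algorithm :: "nat \<Rightarrow> nat \<Rightarrow> nat \<Rightarrow> real \<Rightarrow> (nat \<Rightarrow> real) \<Rightarrow>
    (nat \<Rightarrow> nat \<Rightarrow> real) \<Rightarrow> (nat \<Rightarrow> real) \<Rightarrow> algo \<Rightarrow> bool" where
  "MWIS_algorithm a b d \<beta> f R q B \<longleftrightarrow>
     (\<forall>V E P N w. congest_network a b V E P N \<and> poly_weights d V w \<and> max_degree V E \<ge> 1 \<longrightarrow>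
        bandwidth B V P N w \<beta> \<and>
        success_prob B V P N w (nat \<lfloor>R (card V) (max_degree V E)\<rfloor>)
            (approximates_MWIS V E w (f (max_degree V E)))
          \<ge> 1 - q (card V))"

end

theory Submission
  imports Defs
begin

text \<open>
  Local ratio: in phase \<open>i\<close> with residual weights \<open>W\<^sub>i\<close>, call a node good if \<open>W\<^sub>i(v)\<close> is positive and at
  least half of \<open>\<Sum>\<^bsub>u \<sim> v\<^esub> W\<^sub>i(u)/deg(u)\<close>.  A maximal independent set \<open>J\<^sub>i\<close> of the good nodes has
  \<open>W\<^sub>i(V) \<le> 6\<Delta> W\<^sub>i(J\<^sub>i)\<close>.  Subtract from each node the weight of \<open>J\<^sub>i\<close> in its closed neighbourhood; this
  costs an independent set at most \<open>\<Delta> W\<^sub>i(J\<^sub>i)\<close>.  Unwinding the phases greedily from the last one gives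
  an independent set of weight at least \<open>S = \<Sum>\<^sub>i W\<^sub>i(J\<^sub>i)\<close>, whereas the optimum is at most
  \<open>\<Delta>S + W\<^sub>t(V)\<close> and \<open>t W\<^sub>t(V) \<le> 6\<Delta>S\<close>, so \<open>t \<ge> 6/\<epsilon>\<close> phases suffice.

  The nodes know neither \<open>n\<close>, \<open>\<Delta>\<close> nor the running time of the black box, so they cannot start the
  phases simultaneously.  A phase is a sequence of stages; a node announces the output of a stage
  when it halts in it, and performs a round as soon as it has the messages that this round needs
  from its neighbours.  The asynchronous execution is always a prefix of the ideal one in which a
  stage is run to completion everywhere, and it lags behind by at most one round per stage.

  For the error probability, one seed of the new algorithm encodes \<open>t\<close> seeds of the black box, one
  for each phase.  Given the seeds of the other phases the instance solved in phase \<open>i\<close> is fixed,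
  hence each phase fails with probability at most \<open>p(n)\<close>.
\<close>

section \<open>Local ratio\<close>

text \<open>The black box always runs on all nodes, with the bad ones isolated: its guarantees refer to the
  number of nodes, and the identifiers need not be polynomial in the number of good nodes.\<close>
definition restrict_edges :: "nat set set \<Rightarrow> nat set \<Rightarrow> nat set set" where
  "restrict_edges E S = {e\<in>E. e \<subseteq> S}"

definition good :: "nat set \<Rightarrow> nat set set \<Rightarrow> (nat \<Rightarrow> real) \<Rightarrow> nat set" where
  "good V E W = {v\<in>V. 0 < W v \<and>
     (\<Sum>u\<in>neighbours E v. W u / real (card (neighbours E u))) \<le> 2 * W v}"

text \<open>Cutting off at 0 keeps residual weights nonnegative, as the charging arguments and the
  encoding of weights require. For nonnegative \<open>W\<close>, a node of \<open>J\<close> ends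
  with 0, since it subtracts its own weight too.\<close>

definition reduce :: "nat set set \<Rightarrow> (nat \<Rightarrow> real) \<Rightarrow> nat set \<Rightarrow> nat \<Rightarrow> real" where
  "reduce E W J v = max 0 (W v - sum W (J \<inter> insert v (neighbours E v)))"

section \<open>A single phase: weight captured, cost to an independent set, unwinding\<close>

lemma neighbours_sym: "u \<in> neighbours E v \<longleftrightarrow> v \<in> neighbours E u"
  by (simp add: neighbours_def insert_commute)

context
  fixes V :: "nat set" and E :: "nat set set"
  assumes graph: "simple_graph V E"
begin

lemma finite_V: "finite V" using graph by (simp add: simple_graph_def)

lemma neighbours_subset: "neighbours E v \<subseteq> V"
  using graph by (auto simp: simple_graph_def neighbours_def)

lemma neighbour_in: "u \<in> neighbours E v \<Longrightarrow> u \<in> V"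
  using neighbours_subset by blast

lemma not_own_neighbour: "v \<notin> neighbours E v"
  using graph by (auto simp: simple_graph_def neighbours_def)

lemma finite_neighbours: "finite (neighbours E v)"
  using finite_V neighbours_subset finite_subset by blast

lemma degree_le_max: "v \<in> V \<Longrightarrow> card (neighbours E v) \<le> max_degree V E"
  using finite_V by (auto simp: max_degree_def)

text \<open>Charge each node of \<open>G\<close> to a member of \<open>J\<close> in its closed
  neighbourhood and exchange the order of summation.\<close>

lemma sum_le_sum_closed_neighbourhoods:
  assumes W: "\<And>v. v \<in> V \<Longrightarrow> 0 \<le> (W v :: real)"
    and sub: "G \<subseteq> V" "J \<subseteq> V" and cover: "\<And>v. v \<in> G \<Longrightarrow> J \<inter> insert v (neighbours E v) \<noteq> {}"
  shows "sum W G \<le> (\<Sum>u\<in>J. W u + sum W (neighbours E u))"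
proof -
  have fin: "finite G" "finite J" using sub finite_V finite_subset by blast+
  have "sum W G \<le> (\<Sum>v\<in>G. \<Sum>u\<in>J. if v \<in> insert u (neighbours E u) then W v else 0)"
  proof (rule sum_mono)
    fix v assume v: "v \<in> G"
    obtain u where u: "u \<in> J" "v \<in> insert u (neighbours E u)" using cover[OF v] neighbours_sym by blast
    then have "W v = (if v \<in> insert u (neighbours E u) then W v else 0)" by simp
    also have "\<dots> \<le> (\<Sum>u\<in>J. if v \<in> insert u (neighbours E u) then W v else 0)"
      using W sub v by (intro member_le_sum[OF u(1)]) (auto simp: fin)
    finally show "W v \<le> (\<Sum>u\<in>J. if v \<in> insert u (neighbours E u) then W v else 0)" .
  qed
  also have "\<dots> = (\<Sum>u\<in>J. \<Sum>v\<in>G. if v \<in> insert u (neighbours E u) then W v else 0)"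
    by (rule sum.swap)
  also have "\<dots> \<le> (\<Sum>u\<in>J. W u + sum W (neighbours E u))"
  proof (rule sum_mono)
    fix u assume u: "u \<in> J"
    have "(\<Sum>v\<in>G. if v \<in> insert u (neighbours E u) then W v else 0) = sum W (G \<inter> insert u (neighbours E u))"
      by (rule sum.inter_restrict[OF fin(1), symmetric])
    also have "\<dots> \<le> sum W (insert u (neighbours E u))"
      using u sub neighbour_in W finite_neighbours by (intro sum_mono2) auto
    also have "\<dots> = W u + sum W (neighbours E u)"
      using not_own_neighbour finite_neighbours by simp
    finally show "(\<Sum>v\<in>G. if v \<in> insert u (neighbours E u) then W v else 0) \<le> W u + sum W (neighbours E u)" .
  qed
  finally show ?thesis .
qed

text \<open>Each node spreads its weight evenly over its neighbours; the bad nodes receive in total at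
  most \<open>W(V)\<close>, hence hold at most half of it.\<close>
lemma good_weight:
  assumes W: "\<And>v. v \<in> V \<Longrightarrow> 0 \<le> W v"
  shows "sum W V \<le> 2 * sum W (good V E W)"
proof -
  let ?s = "\<lambda>v. \<Sum>u\<in>neighbours E v. W u / real (card (neighbours E u))"
  have s0: "0 \<le> ?s v" for v using W neighbour_in by (intro sum_nonneg divide_nonneg_nonneg) auto
  have "2 * sum W (V - good V E W) = (\<Sum>v\<in>V - good V E W. 2 * W v)" by (simp add: sum_distrib_left)
  also have "\<dots> \<le> (\<Sum>v\<in>V - good V E W. ?s v)"
  proof (rule sum_mono)
    fix v assume v: "v \<in> V - good V E W"
    show "2 * W v \<le> ?s v"
    proof (cases "W v = 0")
      case True then show ?thesis using s0[of v] by simp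
    next
      case False then show ?thesis using v W[of v] by (auto simp: good_def)
    qed
  qed
  also have "\<dots> \<le> sum ?s V" using s0 finite_V by (intro sum_mono2) auto
  also have "\<dots> = (\<Sum>v\<in>V. \<Sum>u\<in>{u\<in>V. u \<in> neighbours E v}. W u / real (card (neighbours E u)))"
    using neighbours_subset by (intro sum.cong refl) auto
  also have "\<dots> = (\<Sum>u\<in>V. \<Sum>v\<in>{v\<in>V. u \<in> neighbours E v}. W u / real (card (neighbours E u)))"
    by (rule sum.swap_restrict[OF finite_V finite_V])
  also have "\<dots> = (\<Sum>u\<in>V. real (card (neighbours E u)) * (W u / real (card (neighbours E u))))"
  proof (intro sum.cong refl)
    fix u
    have "{v\<in>V. u \<in> neighbours E v} = neighbours E u" using neighbours_sym neighbours_subset by blast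
    then show "(\<Sum>v\<in>{v\<in>V. u \<in> neighbours E v}. W u / real (card (neighbours E u))) =
        real (card (neighbours E u)) * (W u / real (card (neighbours E u)))" by simp
  qed
  \<comment> \<open>The product is \<open>W u\<close> if \<open>u\<close> has neighbours and 0 if it
    has none, because division by zero gives 0.\<close>
  also have "\<dots> \<le> sum W V" using W by (intro sum_mono) auto
  finally have "2 * sum W (V - good V E W) \<le> sum W V" .
  moreover have "sum W V = sum W (good V E W) + sum W (V - good V E W)"
    using finite_V by (simp add: sum.subset_diff[of "good V E W" V] good_def)
  ultimately show ?thesis by simp
qed

text \<open>By maximality each good node has a good member of \<open>I\<close> in its closed
  neighbourhood. The neighbours of a good \<open>u\<close> weigh at most \<Delta> times their
  shares, which goodness bounds by \<open>2 * W u\<close>; so its closed neighbourhood weighs at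
  most 3 \<Delta> times \<open>W u\<close>. The good nodes hold at least half of the weight, which
  doubles 3 to 6.\<close>

lemma MIS_of_good_weight:
  assumes W: "\<And>v. v \<in> V \<Longrightarrow> 0 \<le> W v" and deg: "1 \<le> max_degree V E"
    and I: "maximal_independent_set V (restrict_edges E (good V E W)) I"
  shows "sum W V \<le> 6 * real (max_degree V E) * sum W (I \<inter> good V E W)"
proof -
  let ?G = "good V E W" and ?\<Delta> = "real (max_degree V E)"
  have G: "?G \<subseteq> V" by (auto simp: good_def)
  have IV: "I \<subseteq> V" using I by (auto simp: maximal_independent_set_def independent_set_def)
  have cover: "I \<inter> ?G \<inter> insert v (neighbours E v) \<noteq> {}" if v: "v \<in> ?G" for v
  proof (rule ccontr)
    assume none: "\<not> ?thesis"
    \<comment> \<open>Independence also quantifies over equal pairs, so inserting \<open>v\<close>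
      requires that there is no loop at \<open>v\<close>.\<close>
    have "{v, v} \<notin> E" using not_own_neighbour[of v] by (simp add: neighbours_def)
    then have "independent_set V (restrict_edges E ?G) (insert v I)"
      using I v G none by (auto simp: maximal_independent_set_def independent_set_def restrict_edges_def
          neighbours_def insert_commute)
    then have "insert v I = I" using I by (auto simp: maximal_independent_set_def)
    then show False using none v by auto
  qed
  have "sum W ?G \<le> (\<Sum>u\<in>I \<inter> ?G. W u + sum W (neighbours E u))"
    using G cover by (intro sum_le_sum_closed_neighbourhoods[OF W]) auto
  also have "\<dots> \<le> (\<Sum>u\<in>I \<inter> ?G. 3 * ?\<Delta> * W u)"
  proof (rule sum_mono)
    fix u assume u: "u \<in> I \<inter> ?G"
    have "sum W (neighbours E u) \<le> (\<Sum>x\<in>neighbours E u. ?\<Delta> * (W x / real (card (neighbours E x))))"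
    proof (rule sum_mono)
      fix x assume x: "x \<in> neighbours E u"
      then have xV: "x \<in> V" using neighbours_subset by auto
      have "neighbours E x \<noteq> {}" using x neighbours_sym by auto
      then have pos: "0 < card (neighbours E x)" using finite_neighbours by (simp add: card_gt_0_iff)
      have "W x * real (card (neighbours E x)) \<le> W x * ?\<Delta>"
        using degree_le_max[OF xV] W[OF xV] by (intro mult_left_mono) auto
      then show "W x \<le> ?\<Delta> * (W x / real (card (neighbours E x)))"
        using pos by (simp add: field_simps)
    qed
    also have "\<dots> = ?\<Delta> * (\<Sum>x\<in>neighbours E u. W x / real (card (neighbours E x)))"
      by (simp add: sum_distrib_left)
    also have "\<dots> \<le> ?\<Delta> * (2 * W u)" using u by (intro mult_left_mono) (auto simp: good_def)
    finally have "sum W (neighbours E u) \<le> 2 * ?\<Delta> * W u" by simp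
    moreover have "1 * W u \<le> ?\<Delta> * W u" using deg u G W by (intro mult_right_mono) auto
    ultimately show "W u + sum W (neighbours E u) \<le> 3 * ?\<Delta> * W u" by simp
  qed
  also have "\<dots> = 3 * ?\<Delta> * sum W (I \<inter> ?G)" by (simp add: sum_distrib_left)
  finally show ?thesis using good_weight[of W] W by force
qed

text \<open>In the total that the nodes of \<open>I\<close> lose, a member \<open>u\<close> of
  \<open>J\<close> counts once if it lies in \<open>I\<close>, since then no neighbour does, and
  otherwise at most once for each neighbour.\<close>

lemma reduce_independent:
  assumes W: "\<And>v. v \<in> V \<Longrightarrow> 0 \<le> W v" and deg: "1 \<le> max_degree V E"
    and J: "J \<subseteq> V" and I: "independent_set V E I"
  shows "sum W I \<le> sum (reduce E W J) I + real (max_degree V E) * sum W J"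
proof -
  have IV: "I \<subseteq> V" using I by (simp add: independent_set_def)
  have fin: "finite I" "finite J" using IV J finite_V finite_subset by blast+
  have "sum W I \<le> (\<Sum>v\<in>I. reduce E W J v + sum W {u\<in>J. u \<in> insert v (neighbours E v)})"
    by (rule sum_mono) (auto simp: reduce_def Int_def)
  also have "\<dots> = sum (reduce E W J) I + (\<Sum>v\<in>I. sum W {u\<in>J. u \<in> insert v (neighbours E v)})"
    by (rule sum.distrib)
  also have "(\<Sum>v\<in>I. sum W {u\<in>J. u \<in> insert v (neighbours E v)})
      = (\<Sum>u\<in>J. \<Sum>v\<in>{v\<in>I. u \<in> insert v (neighbours E v)}. W u)"
    by (rule sum.swap_restrict[OF fin])
  also have "\<dots> \<le> (\<Sum>u\<in>J. real (max_degree V E) * W u)"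
  proof (rule sum_mono)
    fix u assume u: "u \<in> J"
    let ?S = "{v\<in>I. u \<in> insert v (neighbours E v)}"
    have "card ?S \<le> max_degree V E"
    proof (cases "u \<in> I")
      case True
      then have "?S \<subseteq> {u}" using I neighbours_sym by (auto simp: independent_set_def neighbours_def)
      then have "card ?S \<le> 1" using card_mono[of "{u}" ?S] by simp
      then show ?thesis using deg by simp
    next
      case False
      then have "?S \<subseteq> neighbours E u" using neighbours_sym by auto
      then show ?thesis using card_mono[OF finite_neighbours] degree_le_max[of u] u J by (meson le_trans subsetD)
    qed
    then show "(\<Sum>v\<in>?S. W u) \<le> real (max_degree V E) * W u"
      using W u J by (simp add: mult_right_mono subset_iff)
  qed
  finally show ?thesis by (simp add: sum_distrib_left)
qed

text \<open>A node of \<open>J\<close> has residual weight 0 and so is not in \<open>F\<close>. On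
  \<open>F\<close> the truncation is inactive, so a node exceeds its residual weight by exactly the
  weight of \<open>J\<close> in its closed neighbourhood. This excess pays for \<open>J - X\<close>,
  each node of which has a neighbour in \<open>F\<close>.\<close>

lemma unwind_step:
  assumes J: "independent_set V E J" and W: "\<And>v. v \<in> V \<Longrightarrow> 0 \<le> W v"
    and F: "independent_set V E F" and pos: "\<And>v. v \<in> F \<Longrightarrow> 0 < reduce E W J v"
    and X: "X = {v\<in>J. neighbours E v \<inter> F = {}}"
  shows "sum (reduce E W J) F + sum W J \<le> sum W (F \<union> X)" "independent_set V E (F \<union> X)"
proof -
  show "independent_set V E (F \<union> X)"
  proof -
    have "{u, v} \<notin> E" "{v, u} \<notin> E" if "u \<in> F" "v \<in> X" for u v
      using that X by (auto simp: neighbours_def insert_commute)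
    then show ?thesis using F J X by (auto simp: independent_set_def)
  qed
  have sub: "F \<subseteq> V" "J \<subseteq> V" using F J by (auto simp: independent_set_def)
  then have fin: "finite F" "finite J" using finite_V finite_subset by blast+
  have disj: "F \<inter> J = {}"
  proof (rule ccontr)
    assume "F \<inter> J \<noteq> {}"
    then obtain v where v: "v \<in> F" "v \<in> J" by auto
    have "sum W {v} \<le> sum W (J \<inter> insert v (neighbours E v))"
      using v sub W by (intro sum_mono2) (auto simp: fin)
    then show False using pos[OF v(1)] by (simp add: reduce_def)
  qed
  have "sum W (J - X) \<le> (\<Sum>u\<in>J. \<Sum>v\<in>{v\<in>F. u \<in> insert v (neighbours E v)}. W u)"
  proof -
    have "sum W (J - X) \<le> (\<Sum>u\<in>J - X. \<Sum>v\<in>{v\<in>F. u \<in> insert v (neighbours E v)}. W u)"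
    proof (rule sum_mono)
      fix u assume u: "u \<in> J - X"
      then obtain v where v: "v \<in> F" "u \<in> neighbours E v" unfolding X using neighbours_sym by blast
      have "(\<Sum>v\<in>{v}. W u) \<le> (\<Sum>v\<in>{v\<in>F. u \<in> insert v (neighbours E v)}. W u)"
        using v u sub W by (intro sum_mono2) (auto simp: fin)
      then show "W u \<le> (\<Sum>v\<in>{v\<in>F. u \<in> insert v (neighbours E v)}. W u)" by simp
    qed
    also have "\<dots> \<le> (\<Sum>u\<in>J. \<Sum>v\<in>{v\<in>F. u \<in> insert v (neighbours E v)}. W u)"
      using sub W by (intro sum_mono2 sum_nonneg) (auto simp: fin)
    finally show ?thesis .
  qed
  also have "\<dots> = (\<Sum>v\<in>F. sum W {u\<in>J. u \<in> insert v (neighbours E v)})"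
    by (rule sum.swap_restrict[OF fin(2,1)])
  also have "\<dots> = (\<Sum>v\<in>F. W v - reduce E W J v)"
  proof (rule sum.cong)
    fix v assume "v \<in> F"
    from pos[OF this] have "reduce E W J v = W v - sum W (J \<inter> insert v (neighbours E v))"
      by (auto simp: reduce_def)
    then show "sum W {u\<in>J. u \<in> insert v (neighbours E v)} = W v - reduce E W J v"
      by (simp add: Int_def)
  qed simp
  finally have "sum W (J - X) + sum (reduce E W J) F \<le> sum W F" by (simp add: sum_subtractf)
  moreover have "sum W J = sum W (J - X) + sum W X"
    using fin X by (intro sum.subset_diff) auto
  moreover have "sum W (F \<union> X) = sum W F + sum W X"
    using fin disj X by (intro sum.union_disjoint) auto
  ultimately show "sum (reduce E W J) F + sum W J \<le> sum W (F \<union> X)" by simp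
qed

end

section \<open>Combination of the phases into the approximation factor\<close>

locale local_ratio =
  fixes V :: "nat set" and E :: "nat set set" and w :: "nat \<Rightarrow> real" and t :: nat
    and W :: "nat \<Rightarrow> nat \<Rightarrow> real" and J X :: "nat \<Rightarrow> nat set"
  assumes graph: "simple_graph V E" and deg: "1 \<le> max_degree V E"
    and W0: "\<And>v. v \<in> V \<Longrightarrow> W 0 v = max 0 (w v)"
    and WSuc: "\<And>i v. v \<in> V \<Longrightarrow> W (Suc i) v = reduce E (W i) (J i) v"
    and J_indep: "\<And>i. i < t \<Longrightarrow> independent_set V E (J i)"
    and J_pos: "\<And>i v. i < t \<Longrightarrow> v \<in> J i \<Longrightarrow> 0 < W i v"
    and J_weight: "\<And>i. i < t \<Longrightarrow> sum (W i) V \<le> 6 * real (max_degree V E) * sum (W i) (J i)"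
    and X: "\<And>k. k < t \<Longrightarrow> X k = {v\<in>J (t - Suc k). neighbours E v \<inter> (\<Union>k'<k. X k') = {}}"
begin

lemma W_nonneg: "v \<in> V \<Longrightarrow> 0 \<le> W i v"
  by (cases i) (auto simp: W0 WSuc reduce_def)

lemma J_subset: "i < t \<Longrightarrow> J i \<subseteq> V"
  using J_indep by (auto simp: independent_set_def)

lemma W_antimono: "v \<in> V \<Longrightarrow> i \<le> j \<Longrightarrow> W j v \<le> W i v" if "j \<le> t"
  using that
proof (induction j)
  case (Suc j)
  have "W (Suc j) v \<le> W j v"
    using Suc W_nonneg J_subset[of j] by (auto simp: WSuc reduce_def intro!: sum_nonneg)
  with Suc show ?case by (cases "i = Suc j") auto
qed simp

text \<open>\<open>X k\<close> unwinds phase \<open>t - Suc k\<close>, so the first \<open>k\<close>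
  of these sets are valued with \<open>W (t - k)\<close>. Positivity belongs to the invariant
  because \<open>unwind_step\<close> works with untruncated residual weights.\<close>

lemma unwind:
  "k \<le> t \<Longrightarrow> independent_set V E (\<Union>j<k. X j) \<and> (\<forall>v\<in>\<Union>j<k. X j. 0 < W (t - k) v) \<and>
    (\<Sum>i=t-k..<t. sum (W i) (J i)) \<le> sum (W (t - k)) (\<Union>j<k. X j)"
proof (induction k)
  case 0 then show ?case by (simp add: independent_set_def)
next
  case (Suc k)
  let ?F = "\<Union>j<k. X j" and ?i = "t - Suc k"
  have i: "?i < t" "t - k = Suc ?i" using Suc.prems by auto
  have F: "independent_set V E ?F" "\<And>v. v \<in> ?F \<Longrightarrow> 0 < W (t - k) v"
    "(\<Sum>i=t-k..<t. sum (W i) (J i)) \<le> sum (W (t - k)) ?F" using Suc by auto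
  have FV: "?F \<subseteq> V" using F(1) by (simp add: independent_set_def)
  have eq: "W (t - k) v = reduce E (W ?i) (J ?i) v" if "v \<in> ?F" for v
    using that FV i WSuc by auto
  have U: "(\<Union>j<Suc k. X j) = ?F \<union> X k" by (auto simp: less_Suc_eq)
  have s: "sum (reduce E (W ?i) (J ?i)) ?F + sum (W ?i) (J ?i) \<le> sum (W ?i) (?F \<union> X k)"
    "independent_set V E (?F \<union> X k)"
    using unwind_step[OF graph J_indep[OF i(1)], where W = "W ?i" and F = ?F and X = "X k"] W_nonneg F(1) F(2) eq X[of k] Suc.prems
    by auto
  have "0 < W ?i v" if "v \<in> ?F \<union> X k" for v
  proof (cases "v \<in> ?F")
    case True
    then have "W (t - k) v \<le> W ?i v" using W_antimono[of "t - k" v ?i] FV i by auto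
    then show ?thesis using F(2)[OF True] by simp
  next
    case False
    then have "v \<in> J ?i" using that X[of k] Suc.prems by auto
    then show ?thesis using J_pos[OF i(1)] by simp
  qed
  moreover have "(\<Sum>i=?i..<t. sum (W i) (J i)) = sum (W ?i) (J ?i) + (\<Sum>i=t-k..<t. sum (W i) (J i))"
    using i by (simp add: sum.atLeast_Suc_lessThan)
  moreover have "sum (W (t - k)) ?F = sum (reduce E (W ?i) (J ?i)) ?F"
    using eq by (rule sum.cong[OF refl])
  ultimately show ?case using s F(3) unfolding U by auto
qed

lemma opt_bound:
  assumes I: "independent_set V E I"
  shows "k \<le> t \<Longrightarrow> sum (W 0) I \<le> sum (W k) I + real (max_degree V E) * (\<Sum>i<k. sum (W i) (J i))"
proof (induction k)
  case (Suc k)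
  have "I \<subseteq> V" using I by (simp add: independent_set_def)
  then have "sum (W (Suc k)) I = sum (reduce E (W k) (J k)) I" by (intro sum.cong) (auto simp: WSuc)
  moreover have "sum (W k) I \<le> sum (reduce E (W k) (J k)) I + real (max_degree V E) * sum (W k) (J k)"
    using Suc.prems J_subset by (intro reduce_independent[OF graph W_nonneg deg _ I]) auto
  ultimately show ?case using Suc by (simp add: distrib_left)
qed simp

theorem approximates:
  assumes eps: "0 < \<epsilon>" and t: "6 / \<epsilon> \<le> real t"
  shows "approximates_MWIS V E w ((1 + \<epsilon>) * real (max_degree V E)) (\<Union>k<t. X k)"
proof -
  let ?F = "\<Union>k<t. X k" and ?\<Delta> = "real (max_degree V E)" and ?S = "\<Sum>i<t. sum (W i) (J i)"
  note u = unwind[of t, simplified]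
  have F: "independent_set V E ?F" using u by blast
  then have FV: "?F \<subseteq> V" by (simp add: independent_set_def)
  have fpos: "0 < W 0 v" if "v \<in> ?F" for v using u that by blast
  \<comment> \<open>All members have positive initial weight, so replacing negative weights by 0
    changed none of theirs.\<close>
  have "sum (W 0) ?F = sum w ?F"
  proof (rule sum.cong[OF refl])
    fix v assume "v \<in> ?F"
    then show "W 0 v = w v" using fpos[of v] FV W0[of v] by auto
  qed
  then have S: "?S \<le> sum w ?F" using u by (simp add: atLeast0LessThan)
  have tpos: "0 < real t" using eps t by (meson divide_pos_pos less_le_trans zero_less_numeral)
  have "sum w I \<le> (1 + \<epsilon>) * ?\<Delta> * sum w ?F" if I: "independent_set V E I" for I
  proof -
    have IV: "I \<subseteq> V" using I by (simp add: independent_set_def)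
    have V: "finite V" using finite_V graph .
    have "sum (W t) I \<le> sum (W t) V" using IV W_nonneg V by (intro sum_mono2) auto
    \<comment> \<open>Residual weights only decrease, so the bound of every phase also bounds the
      final residual weight; adding these bounds gives the factor \<open>real t\<close>
      below.\<close>
    also have rest: "sum (W t) V \<le> 6 * ?\<Delta> * sum (W i) (J i)" if "i < t" for i
    proof -
      have "sum (W t) V \<le> sum (W i) V" using that W_antimono by (intro sum_mono) auto
      then show ?thesis using J_weight[OF that] by simp
    qed
    have "(\<Sum>i<t. sum (W t) V) \<le> (\<Sum>i<t. 6 * ?\<Delta> * sum (W i) (J i))"
      using rest by (intro sum_mono) auto
    then have "real t * sum (W t) V \<le> 6 * ?\<Delta> * ?S" by (simp add: sum_distrib_left)
    moreover have "6 / \<epsilon> * sum (W t) V \<le> real t * sum (W t) V"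
      using t W_nonneg by (intro mult_right_mono sum_nonneg) auto
    ultimately have "6 / \<epsilon> * sum (W t) V \<le> 6 * ?\<Delta> * ?S" by simp
    then have "sum (W t) V \<le> \<epsilon> * ?\<Delta> * ?S" using eps by (simp add: field_simps)
    then have Wt: "sum (W t) I \<le> \<epsilon> * ?\<Delta> * ?S" using \<open>sum (W t) I \<le> sum (W t) V\<close> by simp
    have "sum w I \<le> sum (W 0) I" using IV W0 by (intro sum_mono) (auto simp: subset_iff)
    also have "\<dots> \<le> sum (W t) I + ?\<Delta> * ?S" using opt_bound[OF I, of t] by simp
    also have "\<dots> \<le> (1 + \<epsilon>) * ?\<Delta> * ?S" using Wt by (simp add: algebra_simps)
    also have "\<dots> \<le> (1 + \<epsilon>) * ?\<Delta> * sum w ?F" using S eps by (intro mult_left_mono) auto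
    finally show ?thesis .
  qed
  moreover have "finite {I. independent_set V E I}"
    by (rule finite_subset[of _ "Pow V"]) (auto simp: independent_set_def finite_V[OF graph])
  ultimately show ?thesis using F unfolding approximates_MWIS_def
    by (auto intro!: Max.boundedI[of "sum w ` {J. independent_set V E J}"])
qed

end

section \<open>Asynchronous composition of stages\<close>

text \<open>One entry for each finished stage: the output of the node and those of its neighbours, in port
  order.\<close>
type_synonym history = "(bool list \<times> bool list list) list"

record protocol =
  stages :: nat
  seed_pmf :: "nat pmf"
  stage_send :: "history \<Rightarrow> view \<Rightarrow> nat \<Rightarrow> bool list"
  stage_result :: "history \<Rightarrow> view \<Rightarrow> bool list option"
  decide :: "bool list list \<Rightarrow> bool"

definition stage_sent :: "protocol \<Rightarrow> history \<Rightarrow> view \<Rightarrow> nat \<Rightarrow> bool list" where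
  "stage_sent Q h K i = (if stage_result Q h K = None then stage_send Q h K i else [])"

text \<open>What has been received through one port: the messages and the output of each stage finished by
  the neighbour, and its messages in the current stage.  On the wire, \<open>False # m\<close> is the message \<open>m\<close>
  of the current stage, \<open>True # x\<close> the output \<open>x\<close> that ends it, and the empty string is silence.\<close>
type_synonym log = "(bool list list \<times> bool list) list \<times> bool list list"

definition deliver :: "log \<Rightarrow> bool list \<Rightarrow> log" where
  "deliver = (\<lambda>(dn, cur) m. if m = [] then (dn, cur)
     else if hd m then (dn @ [(cur, tl m)], []) else (dn, cur @ [tl m]))"

definition logs :: "view \<Rightarrow> log list" where
  "logs K = map (\<lambda>j. foldl deliver ([], []) (map (\<lambda>b. b ! j) (inboxes K))) [0..<degree K]"

text \<open>Round \<open>r\<close> uses the messages of the rounds before it. A neighbour that has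
  already ended stage \<open>s\<close> owes no further message in it, hence the first
  disjunct.\<close>

definition available :: "nat \<Rightarrow> nat \<Rightarrow> log \<Rightarrow> bool" where
  "available s r l \<longleftrightarrow> s < length (fst l) \<or> s = length (fst l) \<and> r \<le> length (snd l)"

text \<open>A neighbour that ended the stage before round \<open>r\<close> was silent from then on,
  which reads as the empty message.\<close>

definition logged_message :: "nat \<Rightarrow> nat \<Rightarrow> log \<Rightarrow> bool list" where
  "logged_message s r l = (if s < length (fst l)
     then if r < length (fst (fst l ! s)) then fst (fst l ! s) ! r else [] else snd l ! r)"

definition logged_output :: "nat \<Rightarrow> log \<Rightarrow> bool list" where
  "logged_output s l = snd (fst l ! s)"

text \<open>The own outputs of the finished stages, and the number of rounds made in the current stage.\<close>
type_synonym position = "bool list list \<times> nat"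

definition ready :: "protocol \<Rightarrow> view \<Rightarrow> position \<Rightarrow> bool" where
  "ready Q K p \<longleftrightarrow> length (fst p) < stages Q \<and> (\<forall>l\<in>set (logs K). available (length (fst p)) (snd p) l)"

definition local_history :: "view \<Rightarrow> position \<Rightarrow> history" where
  "local_history K p = map (\<lambda>s. (fst p ! s, map (logged_output s) (logs K))) [0..<length (fst p)]"

text \<open>Each stage starts afresh with the first seed and an empty inbox, so that the view does
  not depend on the real time at which the stage is executed.\<close>

definition local_view :: "view \<Rightarrow> position \<Rightarrow> view" where
  "local_view K p = K\<lparr>seeds := take (Suc (snd p)) (seeds K),
     inboxes := map (\<lambda>k. map (logged_message (length (fst p)) k) (logs K)) [0..<snd p]\<rparr>"

definition advance :: "protocol \<Rightarrow> view \<Rightarrow> position \<Rightarrow> position" where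
  "advance Q K p = (if ready Q K p
     then case stage_result Q (local_history K p) (local_view K p) of
       None \<Rightarrow> (fst p, Suc (snd p)) | Some x \<Rightarrow> (fst p @ [x], 0)
     else p)"

definition emission :: "protocol \<Rightarrow> view \<Rightarrow> position \<Rightarrow> nat \<Rightarrow> bool list" where
  "emission Q K p i = (if ready Q K p
     then case stage_result Q (local_history K p) (local_view K p) of
       None \<Rightarrow> False # stage_send Q (local_history K p) (local_view K p) i | Some x \<Rightarrow> True # x
     else [])"

text \<open>A view does not store the position, so the position is recomputed by replaying the
  prefixes of the view; after \<open>R\<close> rounds a node has drawn \<open>Suc R\<close>
  seeds.\<close>

definition prefix :: "nat \<Rightarrow> view \<Rightarrow> view" where
  "prefix R K = K\<lparr>seeds := take (Suc R) (seeds K), inboxes := take R (inboxes K)\<rparr>"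

primrec position_at :: "protocol \<Rightarrow> view \<Rightarrow> nat \<Rightarrow> position" where
  "position_at Q K 0 = ([], 0)"
| "position_at Q K (Suc R) = advance Q (prefix R K) (position_at Q K R)"

definition position :: "protocol \<Rightarrow> view \<Rightarrow> position" where
  "position Q K = position_at Q K (length (inboxes K))"

definition compose :: "protocol \<Rightarrow> algo" where
  "compose Q = \<lparr>rnd = seed_pmf Q,
     send = \<lambda>K. emission Q K (position Q K),
     result = \<lambda>K. let os = fst (position Q K) in if length os < stages Q then None else Some (decide Q os)\<rparr>"

lemma position_extend:
  assumes "length (seeds K) = Suc (length (inboxes K))"
  shows "position Q (K\<lparr>seeds := seeds K @ [x], inboxes := inboxes K @ [b]\<rparr>) = advance Q K (position Q K)"
proof -
  let ?K = "K\<lparr>seeds := seeds K @ [x], inboxes := inboxes K @ [b]\<rparr>"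
  have pre: "prefix R ?K = prefix R K" if "R \<le> length (inboxes K)" for R
    using that assms by (simp add: prefix_def)
  have "position_at Q ?K R = position_at Q K R" if "R \<le> length (inboxes K)" for R
    using that by (induction R) (simp_all add: pre)
  moreover have "prefix (length (inboxes K)) K = K"
    using assms by (simp add: prefix_def)
  ultimately show ?thesis by (simp add: position_def pre)
qed

section \<open>The ideal execution, stage by stage\<close>

locale protocol_run =
  fixes Q :: protocol and V :: "nat set" and P :: "nat \<Rightarrow> nat list" and N :: nat
    and w :: "nat \<Rightarrow> real" and \<omega> :: "nat \<times> nat \<Rightarrow> nat"
  assumes ports_in: "v \<in> V \<Longrightarrow> u \<in> set (P v) \<Longrightarrow> u \<in> V"
begin

text \<open>Mirrors \<open>view_at\<close> for one stage that all nodes start together, with the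
  history \<open>h u\<close> as additional input of node \<open>u\<close>.\<close>

primrec run :: "(nat \<Rightarrow> history) \<Rightarrow> nat \<Rightarrow> nat \<Rightarrow> view" where
  "run h 0 v =
     \<lparr>ident = v, bound = N, weight = w v, degree = length (P v), seeds = [\<omega> (v, 0)], inboxes = []\<rparr>"
| "run h (Suc r) v =
     (let K = run h r v in
      if stage_result Q (h v) K \<noteq> None then K
      else K\<lparr>seeds := seeds K @ [\<omega> (v, Suc r)],
             inboxes := inboxes K @
               [map (\<lambda>u. stage_sent Q (h u) (run h r u) (port_to P u v)) (P v)]\<rparr>)"

definition stage_time :: "(nat \<Rightarrow> history) \<Rightarrow> nat \<Rightarrow> nat" where
  "stage_time h v = (LEAST r. stage_result Q (h v) (run h r v) \<noteq> None)"

text \<open>The value \<open>[]\<close> for a stage that never ends is arbitrary: no neighbour then passes that stage.\<close>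
definition stage_output :: "(nat \<Rightarrow> history) \<Rightarrow> nat \<Rightarrow> bool list" where
  "stage_output h v = (case stage_result Q (h v) (run h (stage_time h v) v) of None \<Rightarrow> [] | Some x \<Rightarrow> x)"

primrec hist :: "nat \<Rightarrow> nat \<Rightarrow> history" where
  "hist 0 v = []"
| "hist (Suc s) v = hist s v @ [(stage_output (hist s) v, map (stage_output (hist s)) (P v))]"

definition out :: "nat \<Rightarrow> nat \<Rightarrow> bool list" where
  "out s = stage_output (hist s)"

definition outcome :: "nat \<Rightarrow> nat \<Rightarrow> nat \<Rightarrow> bool list option" where
  "outcome s r v = stage_result Q (hist s v) (run (hist s) r v)"

definition msg :: "nat \<Rightarrow> nat \<Rightarrow> nat \<Rightarrow> nat \<Rightarrow> bool list" where
  "msg s r u v = stage_sent Q (hist s u) (run (hist s) r u) (port_to P u v)"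

lemma hist_eq: "hist s v = map (\<lambda>s'. (out s' v, map (out s') (P v))) [0..<s]"
  by (induction s) (simp_all add: out_def)

lemma outcome_frozen:
  assumes "outcome s r v \<noteq> None" "r \<le> r'"
  shows "outcome s r' v = outcome s r v"
proof -
  have "run (hist s) r' v = run (hist s) r v"
    using assms(2)
  proof (induction r' rule: dec_induct)
    case (step k)
    then show ?case using assms(1) by (simp add: outcome_def)
  qed simp
  then show ?thesis by (simp add: outcome_def)
qed

lemma outcome_stage_time:
  "outcome s r v \<noteq> None \<Longrightarrow> outcome s (stage_time (hist s) v) v = Some (out s v)"
  unfolding outcome_def out_def stage_output_def stage_time_def
  by (drule LeastI[where P = "\<lambda>r. stage_result Q (hist s v) (run (hist s) r v) \<noteq> None"])
    (auto split: option.splits)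

lemma outcome_eq_out: assumes "outcome s r v = Some x" shows "x = out s v"
proof -
  have "stage_time (hist s) v \<le> r"
    unfolding stage_time_def by (rule Least_le) (use assms in \<open>simp add: outcome_def\<close>)
  moreover have t: "outcome s (stage_time (hist s) v) v = Some (out s v)"
    by (rule outcome_stage_time[of s r]) (simp add: assms)
  ultimately show ?thesis using outcome_frozen[of s "stage_time (hist s) v" v r] assms by simp
qed

lemma stage_time_eq:
  assumes "outcome s r v \<noteq> None" "\<And>k. k < r \<Longrightarrow> outcome s k v = None"
  shows "stage_time (hist s) v = r"
  unfolding stage_time_def outcome_def[symmetric]
proof (rule Least_equality)
  show "r \<le> k" if "outcome s k v \<noteq> None" for k
    using assms(2)[of k] that by (meson not_le)
qed (rule assms(1))

lemma run_running:
  assumes "\<And>k. k < r \<Longrightarrow> outcome s k v = None"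
  shows "run (hist s) r v = \<lparr>ident = v, bound = N, weight = w v, degree = length (P v),
     seeds = map (\<lambda>k. \<omega> (v, k)) [0..<Suc r], inboxes = map (\<lambda>k. map (\<lambda>u. msg s k u v) (P v)) [0..<r]\<rparr>"
  using assms
proof (induction r)
  case (Suc r)
  then have "run (hist s) r v = \<lparr>ident = v, bound = N, weight = w v, degree = length (P v),
     seeds = map (\<lambda>k. \<omega> (v, k)) [0..<Suc r], inboxes = map (\<lambda>k. map (\<lambda>u. msg s k u v) (P v)) [0..<r]\<rparr>"
    by simp
  moreover have "stage_result Q (hist s v) (run (hist s) r v) = None"
    using Suc.prems[of r] by (simp add: outcome_def)
  ultimately show ?case by (simp add: msg_def)
qed simp

text \<open>What \<open>v\<close> has received from \<open>u\<close> if \<open>u\<close> has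
  followed the ideal execution up to the beginning of round \<open>r\<close> of stage
  \<open>s\<close>.\<close>

definition ideal_log :: "nat \<Rightarrow> nat \<Rightarrow> nat \<Rightarrow> nat \<Rightarrow> log" where
  "ideal_log s r u v = (map (\<lambda>s'. (map (\<lambda>k. msg s' k u v) [0..<stage_time (hist s') u], out s' u)) [0..<s],
     map (\<lambda>k. msg s k u v) [0..<r])"

text \<open>The position lies on the ideal path of \<open>v\<close>: a stage is entered after all
  earlier ones have ended and is left as soon as it ends.\<close>

definition reached :: "nat \<Rightarrow> nat \<Rightarrow> nat \<Rightarrow> bool" where
  "reached s r v \<longleftrightarrow> (\<forall>s'<s. \<exists>k. outcome s' k v \<noteq> None) \<and> (\<forall>k<r. outcome s k v = None)"

text \<open>The ideal execution, too, is silent in the rounds after the end of a stage, which agrees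
  with the empty default of \<open>logged_message\<close>.\<close>

lemma logged_message_ideal:
  assumes "reached su ru u" "available s r (ideal_log su ru u v)" "k < r"
  shows "logged_message s k (ideal_log su ru u v) = msg s k u v"
proof (cases "s < su")
  case True
  then obtain k' where "outcome s k' u \<noteq> None" using assms(1) unfolding reached_def by blast
  then have t: "outcome s (stage_time (hist s) u) u \<noteq> None" by (simp add: outcome_stage_time)
  have "msg s k u v = []" if "stage_time (hist s) u \<le> k"
    using outcome_frozen[OF t that] t by (auto simp: msg_def stage_sent_def outcome_def)
  then show ?thesis using True by (auto simp: logged_message_def ideal_log_def)
next
  case False
  then show ?thesis using assms(2,3) by (auto simp: logged_message_def ideal_log_def available_def)
qed

lemma logged_output_ideal: "s < su \<Longrightarrow> logged_output s (ideal_log su ru u v) = out s u"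
  by (simp add: logged_output_def ideal_log_def)

section \<open>The asynchronous execution as a prefix of the ideal one\<close>

abbreviation real_view :: "nat \<Rightarrow> nat \<Rightarrow> view" where
  "real_view R v \<equiv> view_at (compose Q) P N w \<omega> R v"

definition stage_at :: "nat \<Rightarrow> nat \<Rightarrow> nat" where
  "stage_at R v = length (fst (position Q (real_view R v)))"

definition round_at :: "nat \<Rightarrow> nat \<Rightarrow> nat" where
  "round_at R v = snd (position Q (real_view R v))"

text \<open>The invariant of the simulation. The clauses on the view and its logs are limited to
  running nodes because the view of a halted node is frozen and its inbox stops growing.\<close>

definition faithful :: "nat \<Rightarrow> nat \<Rightarrow> bool" where
  "faithful R v \<longleftrightarrow> (let s = stage_at R v; r = round_at R v; K = real_view R v in
     position Q K = (map (\<lambda>s'. out s' v) [0..<s], r) \<and> reached s r v \<and> s \<le> stages Q \<and>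
     (s < stages Q \<longrightarrow> length (inboxes K) = R \<and> r \<le> R \<and>
       K = \<lparr>ident = v, bound = N, weight = w v, degree = length (P v),
         seeds = map (\<lambda>k. \<omega> (v, k)) [0..<Suc R], inboxes = inboxes K\<rparr> \<and>
       logs K = map (\<lambda>u. ideal_log (stage_at R u) (round_at R u) u v) (P v)))"

lemma result_compose: "result (compose Q) (real_view R v) =
    (if stage_at R v < stages Q then None else Some (decide Q (fst (position Q (real_view R v)))))"
  by (simp add: compose_def stage_at_def Let_def)

text \<open>A ready node holds the earlier outputs of its neighbours and their messages of the
  current stage. By \<open>faithful\<close> these are the ideal ones, so the node reconstructs the
  ideal history and view from them.\<close>

lemma faithful_ready:
  assumes f: "\<And>u. u \<in> V \<Longrightarrow> faithful R u" and v: "v \<in> V"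
    and rdy: "ready Q (real_view R v) (position Q (real_view R v))"
  shows "local_history (real_view R v) (position Q (real_view R v)) = hist (stage_at R v) v"
    "local_view (real_view R v) (position Q (real_view R v)) = run (hist (stage_at R v)) (round_at R v) v"
proof -
  let ?K = "real_view R v" and ?s = "stage_at R v" and ?r = "round_at R v"
  have s: "?s < stages Q" using rdy by (simp add: ready_def stage_at_def)
  have fv: "position Q ?K = (map (\<lambda>s'. out s' v) [0..<?s], ?r)" "reached ?s ?r v" "?r \<le> R"
    "?K = \<lparr>ident = v, bound = N, weight = w v, degree = length (P v),
         seeds = map (\<lambda>k. \<omega> (v, k)) [0..<Suc R], inboxes = inboxes ?K\<rparr>"
    "logs ?K = map (\<lambda>u. ideal_log (stage_at R u) (round_at R u) u v) (P v)"
    using f[OF v] s by (simp_all add: faithful_def Let_def)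
  have av: "available ?s ?r (ideal_log (stage_at R u) (round_at R u) u v)" if "u \<in> set (P v)" for u
    using rdy that fv(1,5) by (simp add: ready_def)
  then have su: "?s \<le> stage_at R u" if "u \<in> set (P v)" for u
    using that by (force simp: available_def ideal_log_def)
  have o: "logged_output s (ideal_log (stage_at R u) (round_at R u) u v) = out s u"
    if "u \<in> set (P v)" "s < ?s" for u s
    using su[OF that(1)] that(2) by (intro logged_output_ideal) simp
  show "local_history ?K (position Q ?K) = hist ?s v"
    by (simp add: local_history_def fv(1,5) hist_eq o)
  have m: "logged_message ?s k (ideal_log (stage_at R u) (round_at R u) u v) = msg ?s k u v"
    if "u \<in> set (P v)" "k < ?r" for u k
  proof -
    have "reached (stage_at R u) (round_at R u) u"
      using f ports_in[OF v that(1)] by (auto simp: faithful_def Let_def)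
    then show ?thesis using av that by (intro logged_message_ideal)
  qed
  have "run (hist ?s) ?r v = \<lparr>ident = v, bound = N, weight = w v, degree = length (P v),
     seeds = map (\<lambda>k. \<omega> (v, k)) [0..<Suc ?r], inboxes = map (\<lambda>k. map (\<lambda>u. msg ?s k u v) (P v)) [0..<?r]\<rparr>"
    using fv(2) by (intro run_running) (simp add: reached_def)
  also have "\<dots> = local_view ?K (position Q ?K)"
  proof -
    have "ident ?K = v" "bound ?K = N" "weight ?K = w v" "degree ?K = length (P v)"
      "seeds ?K = map (\<lambda>k. \<omega> (v, k)) [0..<Suc R]" by (subst fv(4), simp)+
    then show ?thesis using fv(3) unfolding local_view_def fv(1,5)
      by (intro view.equality) (auto simp: take_map m min_def simp del: upt_Suc)
  qed
  finally show "local_view ?K (position Q ?K) = run (hist ?s) ?r v" ..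
qed

lemma faithful_emission:
  assumes f: "\<And>u. u \<in> V \<Longrightarrow> faithful R u" and v: "v \<in> V"
  shows "sent (compose Q) (real_view R v) i =
    (if ready Q (real_view R v) (position Q (real_view R v))
     then case outcome (stage_at R v) (round_at R v) v of
       None \<Rightarrow> False # stage_sent Q (hist (stage_at R v) v) (run (hist (stage_at R v)) (round_at R v) v) i
     | Some x \<Rightarrow> True # x else [])"
proof (cases "ready Q (real_view R v) (position Q (real_view R v))")
  case True
  then have "stage_at R v < stages Q" by (simp add: ready_def stage_at_def)
  with True show ?thesis using faithful_ready[OF f v True]
    by (auto simp: sent_def result_compose) (auto simp: compose_def emission_def stage_sent_def outcome_def
      split: option.splits)
next
  case False
  then show ?thesis by (simp add: sent_def compose_def emission_def)
qed

lemma faithful_advance: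
  assumes f: "\<And>u. u \<in> V \<Longrightarrow> faithful R u" and v: "v \<in> V"
  shows "position Q (real_view (Suc R) v) =
    (if ready Q (real_view R v) (position Q (real_view R v))
     then case outcome (stage_at R v) (round_at R v) v of
       None \<Rightarrow> (fst (position Q (real_view R v)), Suc (round_at R v))
     | Some x \<Rightarrow> (fst (position Q (real_view R v)) @ [x], 0)
     else position Q (real_view R v))"
proof (cases "stage_at R v < stages Q")
  case True
  then have eq: "real_view R v = \<lparr>ident = v, bound = N, weight = w v, degree = length (P v),
         seeds = map (\<lambda>k. \<omega> (v, k)) [0..<Suc R], inboxes = inboxes (real_view R v)\<rparr>"
    "length (inboxes (real_view R v)) = R"
    using f[OF v] by (simp_all add: faithful_def Let_def)
  have len: "length (seeds (real_view R v)) = Suc (length (inboxes (real_view R v)))"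
    by (subst eq(1)) (simp add: eq(2))
  have "result (compose Q) (real_view R v) = None" using True by (simp add: result_compose)
  then have "position Q (real_view (Suc R) v) = advance Q (real_view R v) (position Q (real_view R v))"
    using position_extend[OF len] by (simp add: Let_def)
  then show ?thesis using faithful_ready[OF f v]
    by (simp add: advance_def outcome_def round_at_def split: option.split)
next
  case False
  then have "\<not> ready Q (real_view R v) (position Q (real_view R v))" by (simp add: ready_def stage_at_def)
  then show ?thesis using False by (simp add: result_compose Let_def)
qed

lemma logs_extend:
  assumes "degree K = length xs"
  shows "logs (K\<lparr>seeds := sd, inboxes := inboxes K @ [xs]\<rparr>) = map2 deliver (logs K) xs"
  using assms by (intro nth_equalityI) (auto simp: logs_def)

lemma faithful: "\<forall>v\<in>V. faithful R v"
proof (induction R)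
  case 0
  show ?case
    by (auto simp: faithful_def Let_def position_def stage_at_def round_at_def reached_def logs_def
      ideal_log_def intro!: nth_equalityI)
next
  case (Suc R)
  then have f: "\<And>u. u \<in> V \<Longrightarrow> faithful R u" by auto
  let ?rdy = "\<lambda>v. ready Q (real_view R v) (position Q (real_view R v))"
  \<comment> \<open>What \<open>u\<close> sends is exactly the difference between the ideal logs of
    its old and its new position: nothing, one more message, or the end of a stage.\<close>
  have next_log: "deliver (ideal_log (stage_at R u) (round_at R u) u v) (sent (compose Q) (real_view R u) (port_to P u v))
      = ideal_log (stage_at (Suc R) u) (round_at (Suc R) u) u v" if u: "u \<in> V" for u v
  proof (cases "?rdy u")
    case False
    then show ?thesis using faithful_emission[OF f u] faithful_advance[OF f u]
      by (simp add: deliver_def ideal_log_def stage_at_def round_at_def)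
  next
    case rdy: True
    show ?thesis
    proof (cases "outcome (stage_at R u) (round_at R u) u")
      case None
      then show ?thesis using rdy faithful_emission[OF f u] faithful_advance[OF f u]
        by (simp add: deliver_def ideal_log_def stage_at_def round_at_def msg_def)
    next
      case (Some x)
      \<comment> \<open>No earlier round had an outcome, so the messages collected so far are
        exactly those before \<open>stage_time\<close>.\<close>
      then have "stage_time (hist (stage_at R u)) u = round_at R u"
        using f[OF u] by (intro stage_time_eq) (auto simp: faithful_def Let_def reached_def)
      with Some show ?thesis using rdy faithful_emission[OF f u] faithful_advance[OF f u] outcome_eq_out[OF Some]
        by (simp add: deliver_def ideal_log_def stage_at_def round_at_def)
    qed
  qed
  show ?case
  proof
    fix v assume v: "v \<in> V"
    let ?s = "stage_at R v" and ?r = "round_at R v"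
    have fv: "position Q (real_view R v) = (map (\<lambda>s'. out s' v) [0..<?s], ?r)" "reached ?s ?r v" "?s \<le> stages Q"
      using f[OF v] by (simp_all add: faithful_def Let_def)
    show "faithful (Suc R) v"
    proof (cases "?s < stages Q")
      case False
      then have same: "real_view (Suc R) v = real_view R v" by (simp add: result_compose Let_def)
      then have pos: "stage_at (Suc R) v = ?s" "round_at (Suc R) v = ?r" unfolding stage_at_def round_at_def by simp_all
      show ?thesis using f[OF v] False unfolding faithful_def Let_def same pos by blast
    next
      case True
      have eq: "real_view R v = \<lparr>ident = v, bound = N, weight = w v, degree = length (P v),
           seeds = map (\<lambda>k. \<omega> (v, k)) [0..<Suc R], inboxes = inboxes (real_view R v)\<rparr>"
        "length (inboxes (real_view R v)) = R" "?r \<le> R"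
        "logs (real_view R v) = map (\<lambda>u. ideal_log (stage_at R u) (round_at R u) u v) (P v)"
        using f[OF v] True by (simp_all add: faithful_def Let_def)
      let ?K = "real_view R v"
        and ?b = "map (\<lambda>u. sent (compose Q) (real_view R u) (port_to P u v)) (P v)"
      have K': "real_view (Suc R) v = ?K\<lparr>seeds := seeds ?K @ [\<omega> (v, Suc R)], inboxes := inboxes ?K @ [?b]\<rparr>"
        using True by (simp add: result_compose Let_def)
      have "degree ?K = length (P v)" by (subst eq(1)) simp
      then have "logs (real_view (Suc R) v) = map2 deliver (logs ?K) ?b"
        unfolding K' by (intro logs_extend) simp
      also have "\<dots> = map (\<lambda>u. ideal_log (stage_at (Suc R) u) (round_at (Suc R) u) u v) (P v)"
        unfolding eq(4) using next_log ports_in[OF v] by (intro nth_equalityI) auto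
      finally have lg: "logs (real_view (Suc R) v) = \<dots>" .
      have K'': "real_view (Suc R) v = \<lparr>ident = v, bound = N, weight = w v, degree = length (P v),
           seeds = map (\<lambda>k. \<omega> (v, k)) [0..<Suc (Suc R)], inboxes = inboxes (real_view (Suc R) v)\<rparr>"
        "length (inboxes (real_view (Suc R) v)) = Suc R"
      proof -
        obtain ib b where ib: "ib = inboxes ?K" and b: "b = ?b" by simp
        have e: "?K = \<lparr>ident = v, bound = N, weight = w v, degree = length (P v),
           seeds = map (\<lambda>k. \<omega> (v, k)) [0..<Suc R], inboxes = ib\<rparr>"
          using eq(1) unfolding ib .
        have e': "real_view (Suc R) v = \<lparr>ident = v, bound = N, weight = w v, degree = length (P v),
           seeds = map (\<lambda>k. \<omega> (v, k)) [0..<Suc (Suc R)], inboxes = ib @ [b]\<rparr>"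
        proof -
          have "map (\<lambda>k. \<omega> (v, k)) [0..<Suc R] @ [\<omega> (v, Suc R)] = map (\<lambda>k. \<omega> (v, k)) [0..<Suc (Suc R)]"
            by simp
          then show ?thesis unfolding K'[folded b] e by (simp only: view.simps)
        qed
        show "real_view (Suc R) v = \<lparr>ident = v, bound = N, weight = w v, degree = length (P v),
           seeds = map (\<lambda>k. \<omega> (v, k)) [0..<Suc (Suc R)], inboxes = inboxes (real_view (Suc R) v)\<rparr>"
          unfolding e' by (simp only: view.simps)
        show "length (inboxes (real_view (Suc R) v)) = Suc R"
          unfolding e' view.simps using eq(2) ib by simp
      qed
      have pos: "position Q (real_view (Suc R) v) = (map (\<lambda>s'. out s' v) [0..<stage_at (Suc R) v], round_at (Suc R) v)
         \<and> reached (stage_at (Suc R) v) (round_at (Suc R) v) v \<and> stage_at (Suc R) v \<le> stages Q \<and> round_at (Suc R) v \<le> Suc R"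
        if "position Q (real_view (Suc R) v) = (map (\<lambda>s'. out s' v) [0..<s'], r')"
          "reached s' r' v" "s' \<le> stages Q" "r' \<le> Suc R" for s' r'
      proof -
        have "stage_at (Suc R) v = s'" "round_at (Suc R) v = r'"
          unfolding stage_at_def round_at_def that(1) by simp_all
        then show ?thesis using that by blast
      qed
      have "\<exists>s' r'. position Q (real_view (Suc R) v) = (map (\<lambda>s'. out s' v) [0..<s'], r')
          \<and> reached s' r' v \<and> s' \<le> stages Q \<and> r' \<le> Suc R"
      proof (cases "?rdy v")
        case False
        then have "position Q (real_view (Suc R) v) = position Q (real_view R v)"
          using faithful_advance[OF f v] by presburger
        then show ?thesis using fv eq(3) by (metis le_SucI)
      next
        case rdy: True
        show ?thesis
        proof (cases "outcome ?s ?r v")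
          case None
          then have "position Q (real_view (Suc R) v) = (map (\<lambda>s'. out s' v) [0..<?s], Suc ?r)"
            using faithful_advance[OF f v] rdy fv(1) by (simp del: view_at.simps)
          moreover have "reached ?s (Suc ?r) v" using None fv(2) by (auto simp: reached_def less_Suc_eq)
          ultimately show ?thesis using fv(3) eq(3) by blast
        next
          case (Some x)
          then have "position Q (real_view (Suc R) v) = (map (\<lambda>s'. out s' v) [0..<Suc ?s], 0)"
            using faithful_advance[OF f v] rdy fv(1) outcome_eq_out[OF Some] by (simp del: view_at.simps)
          moreover have "reached (Suc ?s) 0 v" using fv(2) Some by (auto simp: reached_def less_Suc_eq)
          ultimately show ?thesis using True by (meson Suc_leI le0)
        qed
      qed
      then obtain s' r' where "position Q (real_view (Suc R) v) = (map (\<lambda>s'. out s' v) [0..<s'], r')"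
        "reached s' r' v" "s' \<le> stages Q" "r' \<le> Suc R" by blast
      from pos[OF this]
      show ?thesis unfolding faithful_def Let_def using lg K'' by blast
    qed
  qed
qed

section \<open>Messages and number of rounds of the composition\<close>

lemma compose_sent_cases:
  assumes "v \<in> V"
  obtains "sent (compose Q) (real_view R v) i = []"
  | s where "s < stages Q" "sent (compose Q) (real_view R v) i = True # out s v"
  | s r where "s < stages Q"
      "sent (compose Q) (real_view R v) i = False # stage_sent Q (hist s v) (run (hist s) r v) i"
proof (cases "ready Q (real_view R v) (position Q (real_view R v))")
  case True
  then have "stage_at R v < stages Q" by (simp add: ready_def stage_at_def)
  then show ?thesis using True faithful_emission[of R v i] faithful assms that
    by (cases "outcome (stage_at R v) (round_at R v) v") (auto dest: outcome_eq_out)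
next
  case False
  then show ?thesis using faithful_emission[of R v i] faithful assms that by auto
qed

text \<open>A stage costs at most \<open>Suc T\<close> real rounds: up to \<open>T\<close> of its
  own and one to announce its output. Once all nodes have reached round \<open>r\<close> of stage
  \<open>s\<close>, a node that is exactly there is ready and moves on. After the last stage there
  are no rounds left, hence the alternative \<open>s = stages Q\<close>.\<close>

lemma progress:
  assumes halt: "\<And>s v. s < stages Q \<Longrightarrow> v \<in> V \<Longrightarrow> outcome s T v \<noteq> None"
  shows "s * Suc T + r \<le> R \<Longrightarrow> s \<le> stages Q \<Longrightarrow> v \<in> V \<Longrightarrow>
    s < stage_at R v \<or> s = stage_at R v \<and> (r \<le> round_at R v \<or> s = stages Q)"
proof (induction R arbitrary: s r v)
  case 0
  then show ?case by (simp add: stage_at_def position_def)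
next
  case (Suc R)
  have f: "\<And>u. u \<in> V \<Longrightarrow> faithful R u" using faithful by auto
  note adv = faithful_advance[OF f \<open>v \<in> V\<close>]
  have step: "s < stage_at (Suc R) v \<or> s = stage_at (Suc R) v \<and> (Suc r \<le> round_at (Suc R) v \<or> s = stages Q)"
    if le: "s * Suc T + r \<le> R" and s: "s \<le> stages Q" for s r
  proof -
    have all: "s < stage_at R u \<or> s = stage_at R u \<and> (r \<le> round_at R u \<or> s = stages Q)" if "u \<in> V" for u
      using Suc.IH[OF le s that] .
    show ?thesis
    \<comment> \<open>Only a node exactly at the lower bound has to move; the others are ahead or
      have finished, and positions never go back.\<close>
    proof (cases "s = stage_at R v \<and> s < stages Q \<and> round_at R v = r")
      case True
      have "logs (real_view R v) = map (\<lambda>u. ideal_log (stage_at R u) (round_at R u) u v) (P v)"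
        using f[OF \<open>v \<in> V\<close>] True by (simp add: faithful_def Let_def)
      then have "ready Q (real_view R v) (position Q (real_view R v))"
        using True all ports_in[OF \<open>v \<in> V\<close>]
        by (force simp: ready_def available_def ideal_log_def stage_at_def[symmetric] round_at_def[symmetric])
      then show ?thesis using True adv
        by (cases "outcome (stage_at R v) (round_at R v) v") (auto simp: stage_at_def round_at_def)
    next
      case False
      then have "s < stage_at R v \<or> s = stage_at R v \<and> (Suc r \<le> round_at R v \<or> s = stages Q)"
        using all[OF \<open>v \<in> V\<close>] s by auto
      moreover have "stage_at R v < stage_at (Suc R) v \<or> stage_at R v = stage_at (Suc R) v
         \<and> round_at R v \<le> round_at (Suc R) v"
        using adv by (auto simp: stage_at_def round_at_def split: option.splits if_splits)
      ultimately show ?thesis by auto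
    qed
  qed
  show ?case
  proof (cases r)
    case (Suc r')
    then show ?thesis using step[of s r'] Suc.prems by simp
  next
    case 0
    show ?thesis
    proof (cases s)
      case 0
      then show ?thesis using \<open>r = 0\<close> by auto
    next
      case (Suc s')
      have "s' < stage_at (Suc R) v \<or> s' = stage_at (Suc R) v \<and> (Suc T \<le> round_at (Suc R) v \<or> s' = stages Q)"
        using Suc Suc.prems \<open>r = 0\<close> by (intro step) auto
      \<comment> \<open>A node with \<open>Suc T\<close> rounds in stage \<open>s'\<close> would
        have found no outcome in round \<open>T\<close>, contrary to \<open>halt\<close>.\<close>
      moreover have "\<not> (s' = stage_at (Suc R) v \<and> Suc T \<le> round_at (Suc R) v)"
      proof
        assume a: "s' = stage_at (Suc R) v \<and> Suc T \<le> round_at (Suc R) v"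
        have "reached (stage_at (Suc R) v) (round_at (Suc R) v) v"
          using faithful \<open>v \<in> V\<close> unfolding faithful_def Let_def by blast
        then show False using a halt[of s' v] Suc Suc.prems by (auto simp: reached_def)
      qed
      ultimately show ?thesis using Suc Suc.prems \<open>r = 0\<close> by auto
    qed
  qed
qed

theorem compose_result:
  assumes "\<And>s v. s < stages Q \<Longrightarrow> v \<in> V \<Longrightarrow> outcome s T v \<noteq> None"
    and "stages Q * Suc T \<le> R" and v: "v \<in> V"
  shows "result (compose Q) (real_view R v) = Some (decide Q (map (\<lambda>s. out s v) [0..<stages Q]))"
proof -
  have "stages Q \<le> stage_at R v" using progress[OF assms(1), of "stages Q" 0 R v] assms(2) v by auto
  moreover have "position Q (real_view R v) = (map (\<lambda>s'. out s' v) [0..<stage_at R v], round_at R v)"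
    "stage_at R v \<le> stages Q" using faithful v by (auto simp: faithful_def Let_def)
  ultimately show ?thesis by (simp add: result_compose)
qed

end

section \<open>Encoding of the weights\<close>

fun bits :: "nat \<Rightarrow> bool list" where
  "bits n = (if n = 0 then [] else odd n # bits (n div 2))"

declare bits.simps [simp del]

primrec unbits :: "bool list \<Rightarrow> nat" where
  "unbits [] = 0"
| "unbits (b # bs) = of_bool b + 2 * unbits bs"

lemma unbits_bits [simp]: "unbits (bits n) = n"
  by (induction n rule: bits.induct) (subst bits.simps, auto)

lemma two_power_length_bits: "0 < n \<Longrightarrow> 2 ^ length (bits n) \<le> 2 * n"
proof (induction n rule: bits.induct)
  case (1 n)
  have "bits 1 = [True]" using bits.simps[of 1] bits.simps[of 0] by simp
  with 1 show ?case by (cases "n = 1") (auto simp: bits.simps[of n])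
qed

lemma length_bits:
  assumes "n \<le> m ^ k" "2 \<le> m"
  shows "real (length (bits n)) \<le> real k * log 2 m + 1"
proof (cases "n = 0")
  case False
  have "real (length (bits n)) = log 2 (2 ^ length (bits n))" by simp
  also have "\<dots> \<le> log 2 (2 * real m ^ k)"
  proof (intro log_mono)
    have "2 ^ length (bits n) \<le> 2 * n" using False two_power_length_bits by simp
    also have "\<dots> \<le> 2 * m ^ k" using assms by simp
    finally have "real (2 ^ length (bits n)) \<le> real (2 * m ^ k)" by (simp only: of_nat_le_iff)
    then show "(2::real) ^ length (bits n) \<le> 2 * real m ^ k" by simp
  qed auto
  also have "\<dots> = real k * log 2 m + 1" using assms by (simp add: log_mult log_nat_power)
  finally show ?thesis .
qed (use assms in \<open>simp add: bits.simps[of 0]\<close>)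

lemma prod_encode_le: "prod_encode (a, b) \<le> (a + b + 1) ^ 2"
proof -
  have "triangle (a + b) \<le> (a + b) * Suc (a + b)" by (simp add: triangle_def)
  then show ?thesis by (simp add: prod_encode_def power2_eq_square)
qed

text \<open>A rational is written with its least denominator, so that the length of the code is bounded
  although the common denominator of the weights is unknown to the nodes.\<close>
definition denominator :: "real \<Rightarrow> nat" where
  "denominator x = (LEAST q. 0 < q \<and> x * real q \<in> \<int>)"

text \<open>The degree \<open>g\<close> travels along with the weight because the goodness test of a
  neighbour divides the weight by it.\<close>

definition encode :: "real \<Rightarrow> nat \<Rightarrow> bool list" where
  "encode x g = bits (prod_encode (prod_encode (nat \<lfloor>x * real (denominator x)\<rfloor>, denominator x), g))"

definition decode_weight :: "bool list \<Rightarrow> real" where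
  "decode_weight m = (case prod_decode (fst (prod_decode (unbits m))) of (p, q) \<Rightarrow> real p / real q)"

definition decode_degree :: "bool list \<Rightarrow> nat" where
  "decode_degree m = snd (prod_decode (unbits m))"

lemma decode_degree_encode [simp]: "decode_degree (encode x g) = g"
  by (simp add: decode_degree_def encode_def)

context
  fixes x :: real and D :: nat
  assumes x: "0 \<le> x" and D: "1 \<le> D" "x * real D \<in> \<int>"
begin

lemma denominator: "0 < denominator x" "x * real (denominator x) \<in> \<int>" "denominator x \<le> D"
proof -
  have "0 < D \<and> x * real D \<in> \<int>" using D by auto
  from LeastI[where P = "\<lambda>q. 0 < q \<and> x * real q \<in> \<int>", OF this]
    Least_le[where P = "\<lambda>q. 0 < q \<and> x * real q \<in> \<int>", OF this]
  show "0 < denominator x" "x * real (denominator x) \<in> \<int>" "denominator x \<le> D"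
    by (auto simp: denominator_def)
qed

lemma decode_weight_encode: "decode_weight (encode x g) = x"
proof -
  obtain k where k: "x * real (denominator x) = of_int k" using denominator(2) by (auto elim: Ints_cases)
  moreover have "0 \<le> real_of_int k" unfolding k[symmetric] using x by simp
  ultimately have "real (nat \<lfloor>x * real (denominator x)\<rfloor>) = x * real (denominator x)" by simp
  then show ?thesis using denominator(1) by (simp add: decode_weight_def encode_def)
qed

text \<open>Numerator plus denominator plus 1 is at most \<open>M ^ 3\<close>, and pairing at most
  squares this to \<open>M ^ 6\<close>. Adding the degree and 1 gives at most \<open>M ^ 7\<close>,
  and the second pairing \<open>M ^ 14\<close>.\<close>

lemma length_encode:
  assumes "x \<le> real M" "D \<le> M" "g \<le> M" "2 \<le> M"
  shows "real (length (encode x g)) \<le> 14 * log 2 M + 1"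
proof -
  let ?q = "denominator x" and ?p = "nat \<lfloor>x * real (denominator x)\<rfloor>"
  have "x * real ?q \<le> real M * real M"
    using assms denominator(3) x by (intro mult_mono) auto
  then have "\<lfloor>x * real ?q\<rfloor> \<le> \<lfloor>real (M * M)\<rfloor>" by (intro floor_mono) simp
  then have "?p \<le> M * M" unfolding floor_of_nat nat_le_iff .
  then have "?p + ?q + 1 \<le> M * M + M + 1" using denominator(3) assms by simp
  also have "\<dots> \<le> M ^ 3"
  proof -
    have "M * M + M + 1 \<le> M * M + M * M"
      using assms(4) mult_le_mono1[of 2 M M] by linarith
    also have "\<dots> = M * M * 2" by simp
    also have "\<dots> \<le> M * M * M" by (rule mult_le_mono2[OF assms(4)])
    finally show ?thesis by (simp add: power3_eq_cube)
  qed
  finally have "prod_encode (?p, ?q) \<le> (M ^ 3) ^ 2"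
    using prod_encode_le[of ?p ?q] by (meson le_trans power_mono le0)
  then have c: "prod_encode (?p, ?q) \<le> M ^ 6" by (simp flip: power_mult)
  have "prod_encode (?p, ?q) + g + 1 \<le> M ^ 6 + M ^ 6"
  proof -
    have "M * 2 \<le> M * M ^ 5" using assms(4) self_le_power[of M 5] by (intro mult_le_mono2) simp
    then have "M + 1 \<le> M ^ 6" using assms(4) by (simp add: eval_nat_numeral)
    then show ?thesis using c assms(3) by simp
  qed
  also have "\<dots> = 2 * M ^ 6" by simp
  also have "\<dots> \<le> M * M ^ 6" by (rule mult_le_mono1[OF assms(4)])
  also have "\<dots> = M ^ 7" by (simp flip: power_Suc)
  finally have "prod_encode (prod_encode (?p, ?q), g) \<le> (M ^ 7) ^ 2"
    using prod_encode_le[of "prod_encode (?p, ?q)" g] by (meson le_trans power_mono le0)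
  then have "prod_encode (prod_encode (?p, ?q), g) \<le> M ^ 14" by (simp flip: power_mult)
  from length_bits[OF this assms(4)] show ?thesis by (simp add: encode_def)
qed

end

section \<open>The algorithm\<close>

definition select :: "bool list \<Rightarrow> 'a list \<Rightarrow> 'a list" where
  "select flags xs = map snd (filter fst (zip flags xs))"

lemma select_map: "select (map p xs) (map f xs) = map f (filter p xs)"
  by (induction xs) (auto simp: select_def)

text \<open>The view that the black box has in phase \<open>i\<close> on the network restricted to
  the flagged ports, with the dummy weight.\<close>

definition restrict_view :: "bool list \<Rightarrow> nat \<Rightarrow> view \<Rightarrow> view" where
  "restrict_view flags i K = \<lparr>ident = ident K, bound = bound K, weight = 0, degree = length (filter id flags),
     seeds = map (\<lambda>s. list_decode s ! i) (seeds K), inboxes = map (select flags) (inboxes K)\<rparr>"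

text \<open>The offsets 3 and 1 lead to the weights and the elected nodes of the previous phase.\<close>
definition next_weight :: "history \<Rightarrow> view \<Rightarrow> real" where
  "next_weight h K = (if h = [] then max 0 (weight K) else
     let x = fst (h ! (length h - 3)); xs = snd (h ! (length h - 3));
         y = fst (h ! (length h - 1)); ys = snd (h ! (length h - 1))
     in max 0 (decode_weight x - ((if y = [True] then decode_weight x else 0) +
          sum_list (map2 (\<lambda>m j. if j = [True] then decode_weight m else 0) xs ys))))"

definition is_good :: "history \<Rightarrow> bool" where
  "is_good h \<longleftrightarrow> (let x = fst (last h); xs = snd (last h) in 0 < decode_weight x \<and>
     sum_list (map (\<lambda>m. decode_weight m / real (decode_degree m)) xs) \<le> 2 * decode_weight x)"

text \<open>A port counts only if both ends are good, so a bad node runs the black box as an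
  isolated node.\<close>

definition good_ports :: "history \<Rightarrow> bool list" where
  "good_ports h = map (\<lambda>m. fst (last h) = [True] \<and> m = [True]) (snd (last h))"

definition joins :: "nat \<Rightarrow> history \<Rightarrow> bool" where
  "joins t h \<longleftrightarrow> (let k = length h - 3 * t in fst (h ! (3 * (t - Suc k) + 2)) = [True] \<and>
     (\<forall>k'<k. [True] \<notin> set (snd (h ! (3 * t + k')))))"

text \<open>Round \<open>r\<close> of phase \<open>i\<close> uses component \<open>i\<close> of the \<open>r\<close>-th seed, so that the seeds of a phase do not
  depend on the real time at which it is executed.\<close>
definition mwis_seed :: "nat \<Rightarrow> algo \<Rightarrow> nat pmf" where
  "mwis_seed t A = map_pmf (\<lambda>f. list_encode (map f [0..<t])) (Pi_pmf {..<t} 0 (\<lambda>_. rnd A))"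

text \<open>Phase \<open>i < t\<close> consists of stage \<open>3 * i\<close> (residual weight and degree), \<open>3 * i + 1\<close> (goodness) and
  \<open>3 * i + 2\<close> (the black box); stage \<open>3 * t + k\<close> unwinds phase \<open>t - 1 - k\<close>.\<close>
definition mwis :: "nat \<Rightarrow> algo \<Rightarrow> protocol" where
  "mwis t A = \<lparr>stages = 4 * t, seed_pmf = mwis_seed t A,
     stage_send = (\<lambda>h K j. if good_ports h ! j
       then send A (restrict_view (good_ports h) (length h div 3) K) (length (filter id (take j (good_ports h))))
       else []),
     stage_result = (\<lambda>h K. if 3 * t \<le> length h then Some [joins t h]
       else if length h mod 3 = 0 then Some (encode (next_weight h K) (degree K))
       else if length h mod 3 = 1 then Some [is_good h]
       else map_option (\<lambda>b. [b \<and> fst (last h) = [True]])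
         (result A (restrict_view (good_ports h) (length h div 3) K))),
     decide = (\<lambda>os. [True] \<in> set (drop (3 * t) os))\<rparr>"

definition restrict_ports :: "(nat \<Rightarrow> nat list) \<Rightarrow> nat set \<Rightarrow> nat \<Rightarrow> nat list" where
  "restrict_ports P S v = filter (\<lambda>u. v \<in> S \<and> u \<in> S) (P v)"

lemma port_to_eq:
  assumes "distinct (P u)" "j < length (P u)" "P u ! j = v"
  shows "port_to P u v = j"
  unfolding port_to_def using assms
  by (intro Least_equality) (auto simp: nth_eq_iff_index_eq)

text \<open>The new number of a surviving port is the count of surviving ports before it, which is
  how \<open>mwis\<close> renumbers ports when sending.\<close>

lemma port_to_restrict:
  assumes d: "distinct (P u)" and v: "v \<in> set (P u)" "u \<in> S" "v \<in> S"
  shows "port_to (restrict_ports P S) u v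
    = length (filter (\<lambda>x. u \<in> S \<and> x \<in> S) (take (port_to P u v) (P u)))"
proof -
  obtain j where j: "j < length (P u)" "P u ! j = v" using v(1) by (auto simp: in_set_conv_nth)
  let ?m = "\<lambda>x. u \<in> S \<and> x \<in> S"
  have "P u = take j (P u) @ v # drop (Suc j) (P u)" using j id_take_nth_drop by metis
  then have eq: "restrict_ports P S u = filter ?m (take j (P u)) @ v # filter ?m (drop (Suc j) (P u))"
    using v(2,3) unfolding restrict_ports_def by (metis (no_types, lifting) filter.simps(2) filter_append)
  have "distinct (restrict_ports P S u)" using d by (simp add: restrict_ports_def)
  then have "port_to (restrict_ports P S) u v = length (filter ?m (take j (P u)))"
    by (rule port_to_eq) (simp_all add: eq)
  then show ?thesis using port_to_eq[of P u j v] d j by simp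
qed

text \<open>The existential over \<open>r\<close> avoids a reference to the running time, which no
  node knows. Bad nodes are isolated and may enter the maximal independent set, hence the
  restriction to \<open>S\<close>.\<close>

definition elected :: "algo \<Rightarrow> (nat \<Rightarrow> nat list) \<Rightarrow> nat \<Rightarrow> nat set \<Rightarrow> (nat \<times> nat \<Rightarrow> nat) \<Rightarrow> nat set" where
  "elected A P N S \<sigma> = {v\<in>S. \<exists>r. result A (view_at A (restrict_ports P S) N (\<lambda>_. 0) \<sigma> r v) = Some True}"

primrec residual :: "algo \<Rightarrow> nat set \<Rightarrow> nat set set \<Rightarrow> (nat \<Rightarrow> nat list) \<Rightarrow> nat \<Rightarrow> (nat \<Rightarrow> real) \<Rightarrow>
    (nat \<Rightarrow> nat \<times> nat \<Rightarrow> nat) \<Rightarrow> nat \<Rightarrow> nat \<Rightarrow> real" where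
  "residual A V E P N w \<sigma> 0 v = max 0 (w v)"
| "residual A V E P N w \<sigma> (Suc i) v = (let W = residual A V E P N w \<sigma> i
     in reduce E W (elected A P N (good V E W) (\<sigma> i)) v)"

text \<open>The instance of a phase depends only on the seeds of earlier phases; the error bound for
  a single phase rests on this.\<close>

lemma residual_cong:
  assumes "\<And>j. j < i \<Longrightarrow> \<sigma> j = \<sigma>' j"
  shows "residual A V E P N w \<sigma> i = residual A V E P N w \<sigma>' i"
  using assms
proof (induction i)
  case (Suc i)
  then have "residual A V E P N w \<sigma> i = residual A V E P N w \<sigma>' i" "\<sigma> i = \<sigma>' i" by auto
  then show ?case by (intro ext) simp
qed (intro ext, simp)

definition component :: "(nat \<times> nat \<Rightarrow> nat) \<Rightarrow> nat \<Rightarrow> nat \<times> nat \<Rightarrow> nat" where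
  "component \<omega> i x = list_decode (\<omega> x) ! i"

lemma view_at_frozen:
  assumes "result A (view_at A P N w \<omega> r v) \<noteq> None" "r \<le> r'"
  shows "view_at A P N w \<omega> r' v = view_at A P N w \<omega> r v"
  using assms(2) by (induction r' rule: dec_induct) (use assms(1) in auto)

lemma mwis_simps:
  "stages (mwis t A) = 4 * t"
  "stage_send (mwis t A) h K j = (if good_ports h ! j
     then send A (restrict_view (good_ports h) (length h div 3) K) (length (filter id (take j (good_ports h))))
     else [])"
  "stage_result (mwis t A) h K = (if 3 * t \<le> length h then Some [joins t h]
     else if length h mod 3 = 0 then Some (encode (next_weight h K) (degree K))
     else if length h mod 3 = 1 then Some [is_good h]
     else map_option (\<lambda>b. [b \<and> fst (last h) = [True]])
       (result A (restrict_view (good_ports h) (length h div 3) K)))"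
  "decide (mwis t A) os \<longleftrightarrow> [True] \<in> set (drop (3 * t) os)"
  by (simp_all add: mwis_def)

definition weight_stage :: "nat \<Rightarrow> nat" where "weight_stage i = 3 * i"
definition good_stage :: "nat \<Rightarrow> nat" where "good_stage i = 3 * i + 1"
definition elect_stage :: "nat \<Rightarrow> nat" where "elect_stage i = 3 * i + 2"

lemmas stage_defs = weight_stage_def good_stage_def elect_stage_def

lemma stage_arith:
  "weight_stage i mod 3 = 0" "good_stage i mod 3 = 1" "elect_stage i mod 3 = 2" "elect_stage i div 3 = i"
  "3 * t \<le> weight_stage i \<longleftrightarrow> t \<le> i" "3 * t \<le> good_stage i \<longleftrightarrow> t \<le> i" "3 * t \<le> elect_stage i \<longleftrightarrow> t \<le> i"
  unfolding stage_defs by presburger+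

lemma good_stage_Suc: "good_stage i = Suc (weight_stage i)"
  and elect_stage_Suc: "elect_stage i = Suc (good_stage i)"
  by (simp_all add: stage_defs)

lemma weight_stage_Suc_neq_0: "weight_stage (Suc i) \<noteq> 0"
  by (simp add: stage_defs)

lemma component_pair: "component \<omega> i (v, k) = list_decode (\<omega> (v, k)) ! i"
  by (simp add: component_def)

section \<open>Outputs of the stages in the ideal execution\<close>

locale mwis_run =
  fixes A :: algo and t :: nat and V :: "nat set" and E :: "nat set set" and P :: "nat \<Rightarrow> nat list"
    and N :: nat and w :: "nat \<Rightarrow> real" and \<omega> :: "nat \<times> nat \<Rightarrow> nat" and D M :: nat
  assumes graph: "simple_graph V E" and ports: "port_numbering V E P"
    and D: "1 \<le> D" "D \<le> M" and weights: "\<And>v. v \<in> V \<Longrightarrow> \<bar>w v\<bar> \<le> real M \<and> w v * real D \<in> \<int>"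
begin

lemma set_ports: "v \<in> V \<Longrightarrow> set (P v) = neighbours E v"
  and distinct_ports: "v \<in> V \<Longrightarrow> distinct (P v)"
  using ports by (auto simp: port_numbering_def)

lemma length_ports: "v \<in> V \<Longrightarrow> length (P v) = card (neighbours E v)"
  using set_ports distinct_ports distinct_card by metis

sublocale protocol_run "mwis t A" V P N w \<omega>
  using set_ports neighbour_in[OF graph] by unfold_locales auto

abbreviation W :: "nat \<Rightarrow> nat \<Rightarrow> real" where
  "W \<equiv> residual A V E P N w (component \<omega>)"

abbreviation G :: "nat \<Rightarrow> nat set" where
  "G i \<equiv> good V E (W i)"

abbreviation J :: "nat \<Rightarrow> nat set" where
  "J i \<equiv> elected A P N (G i) (component \<omega> i)"

lemma G_subset: "G i \<subseteq> V" by (auto simp: good_def)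
lemma J_subset: "J i \<subseteq> G i" by (auto simp: elected_def)

text \<open>A reduction only adds and subtracts weights, so the common denominator \<open>D\<close>
  survives, and weights never grow: they remain encodable in every phase.\<close>

lemma W_bounds: "v \<in> V \<Longrightarrow> 0 \<le> W i v \<and> W i v \<le> real M \<and> W i v * real D \<in> \<int>"
proof (induction i arbitrary: v)
  case 0
  then show ?case using weights[of v] by (auto simp: max_def)
next
  case (Suc i)
  let ?S = "J i \<inter> insert v (neighbours E v)"
  have S: "?S \<subseteq> V" using G_subset J_subset by blast
  then have "0 \<le> sum (W i) ?S" using Suc.IH by (intro sum_nonneg) auto
  moreover have "sum (W i) ?S * real D \<in> \<int>"
    unfolding sum_distrib_right using S Suc.IH by (intro Ints_sum) auto
  ultimately show ?case using Suc.IH[OF Suc.prems]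
    by (auto simp: reduce_def Let_def max_def left_diff_distrib)
qed

lemma decode_W: "v \<in> V \<Longrightarrow> decode_weight (encode (W i v) g) = W i v"
  using W_bounds D by (intro decode_weight_encode) auto

text \<open>Applies to all stages but the elections: they end in round 0 without exchanging
  messages.\<close>

lemma out_immediate:
  assumes "stage_result (mwis t A) (hist s v) (run (hist s) 0 v) = Some x"
  shows "out s v = x" "outcome s r v \<noteq> None"
proof -
  have "outcome s 0 v = Some x" using assms by (simp add: outcome_def)
  then show "out s v = x" "outcome s r v \<noteq> None"
    using outcome_eq_out outcome_frozen[of s 0 v r] by auto
qed

lemma length_hist [simp]: "length (hist s v) = s" by (simp add: hist_eq)

lemma nth_hist: "s' < s \<Longrightarrow> hist s v ! s' = (out s' v, map (out s') (P v))"
  by (simp add: hist_eq)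

lemma last_hist: "last (hist (Suc s) v) = (out s v, map (out s) (P v))"
  by (simp add: out_def)

lemma sum_ports: "v \<in> V \<Longrightarrow> sum_list (map f (P v)) = (\<Sum>u\<in>neighbours E v. f u :: real)"
  using set_ports distinct_ports by (metis sum_list_distinct_conv_sum_set)

lemma out_weight_0: assumes "0 < t" "v \<in> V"
  shows "out (weight_stage 0) v = encode (W 0 v) (length (P v))" "outcome (weight_stage 0) r v \<noteq> None"
proof -
  have "stage_result (mwis t A) (hist (weight_stage 0) v) (run (hist (weight_stage 0)) 0 v) = Some (encode (W 0 v) (length (P v)))"
    using assms by (simp add: mwis_simps next_weight_def stage_defs)
  then show "out (weight_stage 0) v = encode (W 0 v) (length (P v))" "outcome (weight_stage 0) r v \<noteq> None"
    by (rule out_immediate)+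
qed

lemma out_good:
  assumes i: "i < t" and v: "v \<in> V"
    and wt: "\<And>u. u \<in> V \<Longrightarrow> out (weight_stage i) u = encode (W i u) (length (P u))"
  shows "out (good_stage i) v = [v \<in> G i]" "outcome (good_stage i) r v \<noteq> None"
proof -
  have nb: "u \<in> V" if "u \<in> set (P v)" for u using that ports_in v by blast
  have "is_good (hist (good_stage i) v) \<longleftrightarrow> v \<in> G i"
  proof -
    have "map (\<lambda>m. decode_weight m / real (decode_degree m)) (map (out (weight_stage i)) (P v)) =
        map (\<lambda>u. W i u / real (card (neighbours E u))) (P v)"
      using nb by (simp add: wt decode_W length_ports)
    then have "sum_list (map (\<lambda>m. decode_weight m / real (decode_degree m)) (map (out (weight_stage i)) (P v))) =
        (\<Sum>u\<in>neighbours E v. W i u / real (card (neighbours E u)))"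
      using sum_ports[OF v] by presburger
    moreover have "last (hist (good_stage i) v) = (out (weight_stage i) v, map (out (weight_stage i)) (P v))"
      unfolding good_stage_Suc by (rule last_hist)
    ultimately show ?thesis using v unfolding is_good_def Let_def by (simp only: fst_conv snd_conv) (simp add: wt decode_W good_def)
  qed
  then have "stage_result (mwis t A) (hist (good_stage i) v) (run (hist (good_stage i)) 0 v) = Some [v \<in> G i]"
    using i by (simp add: mwis_simps stage_arith)
  then show "out (good_stage i) v = [v \<in> G i]" "outcome (good_stage i) r v \<noteq> None"
    by (rule out_immediate)+
qed

context
  fixes i
  assumes i: "i < t" and gd: "\<And>u. u \<in> V \<Longrightarrow> out (good_stage i) u = [u \<in> G i]"
begin

lemma good_ports_eq: "v \<in> V \<Longrightarrow> good_ports (hist (elect_stage i) v) = map (\<lambda>u. v \<in> G i \<and> u \<in> G i) (P v)"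
  unfolding good_ports_def elect_stage_Suc last_hist using ports_in by (auto simp: gd)

lemma stage_result_elect: "v \<in> V \<Longrightarrow> stage_result (mwis t A) (hist (elect_stage i) v) K =
    map_option (\<lambda>b. [b \<and> v \<in> G i]) (result A (restrict_view (good_ports (hist (elect_stage i) v)) i K))"
proof -
  assume v: "v \<in> V"
  have "last (hist (elect_stage i) v) = (out (good_stage i) v, map (out (good_stage i)) (P v))"
    unfolding elect_stage_Suc by (rule last_hist)
  then show ?thesis using i gd[OF v] by (simp add: mwis_simps stage_arith)
qed

text \<open>\<open>select\<close> keeps exactly the messages from flagged ports, and by
  \<open>port_to_restrict\<close> the sender uses the port number of the restricted network. Hence
  each round inside the stage is a round of the black box there.\<close>

lemma restrict_view_run:
  "v \<in> V \<Longrightarrow> restrict_view (good_ports (hist (elect_stage i) v)) i (run (hist (elect_stage i)) r v) =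
    view_at A (restrict_ports P (G i)) N (\<lambda>_. 0) (component \<omega> i) r v"
proof (induction r arbitrary: v)
  case 0
  then show ?case by (simp add: good_ports_eq restrict_view_def restrict_ports_def component_pair filter_map
      o_def)
next
  case (Suc r)
  let ?s = "elect_stage i" and ?P = "restrict_ports P (G i)"
  let ?view = "view_at A ?P N (\<lambda>_. 0) (component \<omega> i) r"
  have "select (good_ports (hist ?s v)) (map (\<lambda>u. stage_sent (mwis t A) (hist ?s u) (run (hist ?s) r u) (port_to P u v)) (P v))
    = map (\<lambda>u. stage_sent (mwis t A) (hist ?s u) (run (hist ?s) r u) (port_to P u v)) (?P v)"
    unfolding good_ports_eq[OF Suc.prems] select_map restrict_ports_def ..
  also have "\<dots> = map (\<lambda>u. sent A (?view u) (port_to ?P u v)) (?P v)"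
  proof (rule map_cong[OF refl])
    fix u assume "u \<in> set (?P v)"
    then have u: "u \<in> set (P v)" "v \<in> G i" "u \<in> G i" by (auto simp: restrict_ports_def)
    have uV: "u \<in> V" using u G_subset by blast
    have vu: "v \<in> set (P u)" using u Suc.prems uV set_ports neighbours_sym by metis
    then obtain j where j: "j < length (P u)" "P u ! j = v" by (auto simp: in_set_conv_nth)
    then have port: "port_to P u v = j" using port_to_eq distinct_ports[OF uV] by blast
    have "length (filter id (take j (good_ports (hist ?s u)))) = port_to ?P u v"
      unfolding port_to_restrict[of P u v "G i", OF distinct_ports[OF uV] vu u(3,2)] port good_ports_eq[OF uV]
      by (simp add: take_map filter_map o_def)
    then have "stage_send (mwis t A) (hist ?s u) (run (hist ?s) r u) j = send A (?view u) (port_to ?P u v)"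
      using j u Suc.IH[OF uV] by (simp add: mwis_simps good_ports_eq[OF uV] stage_arith)
    then show "stage_sent (mwis t A) (hist ?s u) (run (hist ?s) r u) (port_to P u v) = sent A (?view u) (port_to ?P u v)"
      using Suc.IH[OF uV] by (simp add: port stage_sent_def sent_def stage_result_elect[OF uV])
  qed
  finally have box: "select (good_ports (hist ?s v)) (map (\<lambda>u. stage_sent (mwis t A) (hist ?s u) (run (hist ?s) r u) (port_to P u v)) (P v)) = \<dots>" .
  have res: "stage_result (mwis t A) (hist ?s v) (run (hist ?s) r v) = None \<longleftrightarrow> result A (?view v) = None"
    by (simp add: stage_result_elect[OF Suc.prems] Suc.IH[OF Suc.prems])
  show ?case
  proof (cases "result A (?view v) = None")
    case True
    have IH: "?view v = restrict_view (good_ports (hist ?s v)) i (run (hist ?s) r v)"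
      using Suc.IH[OF Suc.prems] ..
    have "run (hist ?s) (Suc r) v = (run (hist ?s) r v)\<lparr>seeds := seeds (run (hist ?s) r v) @ [\<omega> (v, Suc r)],
       inboxes := inboxes (run (hist ?s) r v) @
         [map (\<lambda>u. stage_sent (mwis t A) (hist ?s u) (run (hist ?s) r u) (port_to P u v)) (P v)]\<rparr>"
      using True res by (simp add: Let_def)
    moreover have "view_at A ?P N (\<lambda>_. 0) (component \<omega> i) (Suc r) v = (?view v)\<lparr>
        seeds := seeds (?view v) @ [component \<omega> i (v, Suc r)],
        inboxes := inboxes (?view v) @ [map (\<lambda>u. sent A (?view u) (port_to ?P u v)) (?P v)]\<rparr>"
      using True by (simp add: Let_def)
    ultimately show ?thesis unfolding IH
      by (simp add: restrict_view_def box component_pair del: hist.simps run.simps view_at.simps)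
  next
    case False
    then show ?thesis using res Suc.IH[OF Suc.prems] by (auto simp: Let_def)
  qed
qed

lemma outcome_elect: "v \<in> V \<Longrightarrow> outcome (elect_stage i) r v = map_option (\<lambda>b. [b \<and> v \<in> G i])
    (result A (view_at A (restrict_ports P (G i)) N (\<lambda>_. 0) (component \<omega> i) r v))"
  by (simp add: outcome_def stage_result_elect restrict_view_run)

text \<open>The default output \<open>[]\<close> of a stage that never ends differs from
  \<open>[True]\<close>, so the equivalence holds even without termination.\<close>

lemma out_elect: assumes v: "v \<in> V" shows "out (elect_stage i) v = [True] \<longleftrightarrow> v \<in> J i"
proof
  assume o: "out (elect_stage i) v = [True]"
  then have "outcome (elect_stage i) (stage_time (hist (elect_stage i)) v) v = Some [True]"
    by (simp add: out_def stage_output_def outcome_def split: option.splits)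
  then show "v \<in> J i" by (auto simp: outcome_elect[OF v] elected_def)
next
  assume "v \<in> J i"
  then obtain r where "outcome (elect_stage i) r v = Some [True]"
    by (auto simp: outcome_elect[OF v] elected_def)
  then show "out (elect_stage i) v = [True]" using outcome_eq_out by metis
qed

lemma length_out_elect: "v \<in> V \<Longrightarrow> length (out (elect_stage i) v) \<le> 1"
  using outcome_elect[of v "stage_time (hist (elect_stage i)) v"]
  by (auto simp: out_def stage_output_def outcome_def split: option.splits)

lemma sent_elect:
  assumes v: "v \<in> V" and j: "j < length (P v)"
  shows "stage_sent (mwis t A) (hist (elect_stage i) v) (run (hist (elect_stage i)) r v) j = [] \<or>
    (\<exists>j'<length (restrict_ports P (G i) v).
      stage_sent (mwis t A) (hist (elect_stage i) v) (run (hist (elect_stage i)) r v) j =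
      sent A (view_at A (restrict_ports P (G i)) N (\<lambda>_. 0) (component \<omega> i) r v) j')"
proof (cases "v \<in> G i \<and> P v ! j \<in> G i")
  case True
  let ?m = "\<lambda>u. v \<in> G i \<and> u \<in> G i"
  have "P v = take j (P v) @ P v ! j # drop (Suc j) (P v)" using j id_take_nth_drop by metis
  then have "restrict_ports P (G i) v = filter ?m (take j (P v)) @ P v ! j # filter ?m (drop (Suc j) (P v))"
    using True unfolding restrict_ports_def by (metis (no_types, lifting) filter.simps(2) filter_append)
  then have "length (filter ?m (take j (P v))) < length (restrict_ports P (G i) v)" by simp
  moreover have "length (filter id (take j (good_ports (hist (elect_stage i) v)))) = length (filter ?m (take j (P v)))"
    unfolding good_ports_eq[OF v] by (simp add: take_map filter_map o_def)
  ultimately show ?thesis using True j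
    by (intro disjI2 exI[of _ "length (filter ?m (take j (P v)))"])
      (simp add: stage_sent_def sent_def stage_result_elect[OF v] restrict_view_run[OF v, symmetric],
       simp add: mwis_simps good_ports_eq[OF v] stage_arith)
next
  case False
  then have "stage_send (mwis t A) (hist (elect_stage i) v) (run (hist (elect_stage i)) r v) j = []"
    using j by (auto simp: mwis_simps good_ports_eq[OF v])
  then show ?thesis by (simp add: stage_sent_def)
qed

lemma out_weight_Suc:
  assumes wt: "\<And>u. u \<in> V \<Longrightarrow> out (weight_stage i) u = encode (W i u) (length (P u))"
    and Suc_i: "Suc i < t" and v: "v \<in> V"
  shows "out (weight_stage (Suc i)) v = encode (W (Suc i) v) (length (P v))" "outcome (weight_stage (Suc i)) r v \<noteq> None"
proof -
  let ?h = "hist (weight_stage (Suc i)) v"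
  have nb: "u \<in> V" if "u \<in> set (P v)" for u using that ports_in v by blast
  have idx: "?h ! (weight_stage (Suc i) - 3) = (out (weight_stage i) v, map (out (weight_stage i)) (P v))"
    "?h ! (weight_stage (Suc i) - 1) = (out (elect_stage i) v, map (out (elect_stage i)) (P v))"
    using nth_hist[of "weight_stage i" "weight_stage (Suc i)" v] nth_hist[of "elect_stage i" "weight_stage (Suc i)" v]
    by (simp_all add: stage_defs)
  have "map2 (\<lambda>m j. if j = [True] then decode_weight m else 0) (map (out (weight_stage i)) (P v)) (map (out (elect_stage i)) (P v))
      = map (\<lambda>u. if u \<in> J i then W i u else 0) (P v)"
    using nb by (intro nth_equalityI) (auto simp: wt decode_W out_elect)
  then have "sum_list (map2 (\<lambda>m j. if j = [True] then decode_weight m else 0) (map (out (weight_stage i)) (P v)) (map (out (elect_stage i)) (P v)))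
      = (\<Sum>u\<in>neighbours E v. if u \<in> J i then W i u else 0)"
    using v by (simp add: sum_ports)
  \<comment> \<open>The own term and those of the neighbours form the sum over the closed
    neighbourhood, as no node is its own neighbour.\<close>
  then have "(if out (elect_stage i) v = [True] then decode_weight (out (weight_stage i) v) else 0) +
      sum_list (map2 (\<lambda>m j. if j = [True] then decode_weight m else 0) (map (out (weight_stage i)) (P v)) (map (out (elect_stage i)) (P v)))
      = (\<Sum>u\<in>insert v (neighbours E v). if u \<in> J i then W i u else 0)"
    using v not_own_neighbour[OF graph] finite_neighbours[OF graph] by (simp add: wt decode_W out_elect)
  also have "\<dots> = sum (W i) (insert v (neighbours E v) \<inter> J i)"
    using finite_neighbours[OF graph] by (intro sum.inter_restrict[symmetric]) simp
  finally have "next_weight ?h K = W (Suc i) v" for K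
    using v weight_stage_Suc_neq_0[of i] unfolding next_weight_def Let_def length_hist idx
    by (auto simp: reduce_def Let_def Int_commute wt decode_W hist_eq)
  then have "stage_result (mwis t A) ?h (run (hist (weight_stage (Suc i))) 0 v) = Some (encode (W (Suc i) v) (length (P v)))"
    using Suc_i by (simp add: mwis_simps stage_arith del: residual.simps)
  then show "out (weight_stage (Suc i)) v = encode (W (Suc i) v) (length (P v))" "outcome (weight_stage (Suc i)) r v \<noteq> None"
    by (rule out_immediate)+
qed

end

lemma out_weight_good:
  "i < t \<Longrightarrow> (\<forall>v\<in>V. out (weight_stage i) v = encode (W i v) (length (P v)) \<and> (\<forall>r. outcome (weight_stage i) r v \<noteq> None)) \<and>
    (\<forall>v\<in>V. out (good_stage i) v = [v \<in> G i] \<and> (\<forall>r. outcome (good_stage i) r v \<noteq> None))"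
proof (induction i)
  case 0
  then show ?case using out_weight_0 out_good[of 0] by blast
next
  case (Suc i)
  have w': "out (weight_stage (Suc i)) v = encode (W (Suc i) v) (length (P v))" "outcome (weight_stage (Suc i)) r v \<noteq> None"
    if "v \<in> V" for v r using out_weight_Suc(1)[of i v] out_weight_Suc(2)[of i v r] Suc that by auto
  show ?case using w' out_good[of "Suc i"] Suc.prems by blast
qed

lemmas out_weight = out_weight_good[THEN conjunct1, rule_format, THEN conjunct1]
lemmas out_good_stage = out_weight_good[THEN conjunct2, rule_format, THEN conjunct1]

section \<open>Unwinding, correctness and message lengths of the algorithm\<close>

definition X :: "nat \<Rightarrow> nat set" where
  "X k = {v\<in>V. out (3 * t + k) v = [True]}"

lemma out_join:
  "stage_result (mwis t A) (hist (3 * t + k) v) (run (hist (3 * t + k)) 0 v) = Some [joins t (hist (3 * t + k) v)]"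
  by (simp add: mwis_simps)

text \<open>Connects the distributed unwinding with the recursion assumed in
  \<open>local_ratio\<close>.\<close>

lemma X_eq: assumes k: "k < t"
  shows "X k = {v\<in>J (t - Suc k). neighbours E v \<inter> (\<Union>k'<k. X k') = {}}"
proof -
  have "out (3 * t + k) v = [True] \<longleftrightarrow> v \<in> J (t - Suc k) \<and> neighbours E v \<inter> (\<Union>k'<k. X k') = {}"
    if v: "v \<in> V" for v
  proof -
    have i: "t - Suc k < t" using k by simp
    have lt: "elect_stage (t - Suc k) < 3 * t + k" using k by (simp add: stage_defs)
    have "joins t (hist (3 * t + k) v) \<longleftrightarrow> out (elect_stage (t - Suc k)) v = [True] \<and>
        (\<forall>k'<k. \<forall>u\<in>set (P v). out (3 * t + k') u \<noteq> [True])"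
      using nth_hist[OF lt, of v] unfolding stage_defs
      by (simp add: joins_def nth_hist image_iff eq_commute[of "[True]"])
    also have "\<dots> \<longleftrightarrow> v \<in> J (t - Suc k) \<and> neighbours E v \<inter> (\<Union>k'<k. X k') = {}"
    proof -
      have "neighbours E v \<inter> (\<Union>k'<k. X k') = {} \<longleftrightarrow> (\<forall>k'<k. \<forall>u\<in>set (P v). out (3 * t + k') u \<noteq> [True])"
        using neighbour_in[OF graph] unfolding X_def set_ports[OF v] by blast
      then show ?thesis using out_elect[OF i out_good_stage[OF i] v] by simp
    qed
    finally show ?thesis using out_immediate(1)[OF out_join] by simp
  qed
  moreover have "J (t - Suc k) \<subseteq> V" using J_subset G_subset by blast
  ultimately show ?thesis unfolding X_def[of k] by blast
qed

lemma stage_cases: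
  assumes "s < 4 * t"
  obtains i where "i < t" "s = weight_stage i" | i where "i < t" "s = good_stage i" | i where "i < t" "s = elect_stage i"
    | k where "k < t" "s = 3 * t + k"
proof (cases "s < 3 * t")
  case True
  then have "s div 3 < t" by auto
  moreover have "s = weight_stage (s div 3) \<or> s = good_stage (s div 3) \<or> s = elect_stage (s div 3)"
    unfolding stage_defs by presburger
  ultimately show ?thesis using that by blast
next
  case False
  then show ?thesis using that(4)[of "s - 3 * t"] assms by auto
qed

lemma finishes_mwis:
  assumes deg: "1 \<le> max_degree V E" and eps: "0 < \<epsilon>" and t: "6 / \<epsilon> \<le> real t"
    and fin: "\<And>i. i < t \<Longrightarrow> finishes A V (restrict_ports P (G i)) N (\<lambda>_. 0) T
      (maximal_independent_set V (restrict_edges E (G i))) (component \<omega> i)"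
    and R: "4 * t * Suc T \<le> R"
  shows "finishes (compose (mwis t A)) V P N w R (approximates_MWIS V E w ((1 + \<epsilon>) * real (max_degree V E))) \<omega>"
proof -
  let ?I = "\<lambda>i. {v\<in>V. result A (view_at A (restrict_ports P (G i)) N (\<lambda>_. 0) (component \<omega> i) T v) = Some True}"
  have halt: "result A (view_at A (restrict_ports P (G i)) N (\<lambda>_. 0) (component \<omega> i) T v) \<noteq> None"
    if "i < t" "v \<in> V" for i v using fin[OF that(1)] that(2) by (auto simp: finishes_def)
  have MIS: "maximal_independent_set V (restrict_edges E (G i)) (?I i)" if "i < t" for i
    using fin[OF that] by (simp add: finishes_def)
  \<comment> \<open>Outputs are irrevocable and all nodes have halted by round \<open>T\<close>, so
    a decision found in any round is the one of round \<open>T\<close>.\<close>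
  have J: "J i = ?I i \<inter> G i" if i: "i < t" for i
  proof (intro equalityI subsetI)
    fix v assume v: "v \<in> J i"
    then obtain r where r: "result A (view_at A (restrict_ports P (G i)) N (\<lambda>_. 0) (component \<omega> i) r v) = Some True"
      by (auto simp: elected_def)
    have vV: "v \<in> V" using v J_subset G_subset by blast
    have "result A (view_at A (restrict_ports P (G i)) N (\<lambda>_. 0) (component \<omega> i) T v) = Some True"
      using view_at_frozen[of A _ _ _ _ r v T] view_at_frozen[of A _ _ _ _ T v r] halt[OF i vV] r
      by (metis nle_le option.distinct(1))
    then show "v \<in> ?I i \<inter> G i" using v vV J_subset by auto
  qed (auto simp: elected_def)
  interpret local_ratio V E w t W J X
  proof
    fix i assume i: "i < t"
    \<comment> \<open>Restriction keeps all edges between good nodes, so for good nodes independence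
      there is independence in \<open>E\<close>.\<close>
    show "independent_set V E (J i)"
      using MIS[OF i] unfolding J[OF i] by (auto simp: maximal_independent_set_def independent_set_def restrict_edges_def)
    show "sum (W i) V \<le> 6 * real (max_degree V E) * sum (W i) (J i)"
      unfolding J[OF i] using W_bounds by (intro MIS_of_good_weight[OF graph _ deg MIS[OF i]]) auto
    show "0 < W i v" if "v \<in> J i" for v using that by (auto simp: elected_def good_def)
  qed (use graph deg X_eq in \<open>simp_all add: Let_def\<close>)
  have out: "outcome s T v \<noteq> None" if "s < stages (mwis t A)" "v \<in> V" for s v
  proof -
    have "s < 4 * t" using that by (simp add: mwis_simps)
    then show ?thesis
    proof (cases rule: stage_cases)
      case (3 i)
      then show ?thesis using outcome_elect[OF 3(1) out_good_stage[OF 3(1)] that(2), of T] halt[OF 3(1) that(2)] by auto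
    next
      case (4 k)
      then show ?thesis using out_immediate(2)[OF out_join] by blast
    qed (use out_weight_good that in blast)+
  qed
  have res: "result (compose (mwis t A)) (real_view R v) = Some (v \<in> (\<Union>k<t. X k))" if v: "v \<in> V" for v
  proof -
    have "drop (3 * t) (map (\<lambda>s. out s v) [0..<4 * t]) = map (\<lambda>k. out (3 * t + k) v) [0..<t]"
      by (intro nth_equalityI) auto
    then have "decide (mwis t A) (map (\<lambda>s. out s v) [0..<stages (mwis t A)]) \<longleftrightarrow> v \<in> (\<Union>k<t. X k)"
      using v by (force simp: mwis_simps X_def)
    then show ?thesis using compose_result[of T R v] out R v by (simp add: mwis_simps)
  qed
  have "{v\<in>V. result (compose (mwis t A)) (real_view R v) = Some True} = {v\<in>V. v \<in> (\<Union>k<t. X k)}"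
    using res by (auto simp del: UN_iff)
  also have "\<dots> = (\<Union>k<t. X k)" by (auto simp: X_def)
  finally have "{v\<in>V. result (compose (mwis t A)) (real_view R v) = Some True} = (\<Union>k<t. X k)" .
  then show ?thesis using res approximates[OF eps t] by (simp add: finishes_def)
qed

text \<open>A nonempty real message is a tag bit, which accounts for the additive 1, followed by a
  message or an output of a stage. The messages come from the black box; the outputs are encoded
  weights or have at most one bit.\<close>

lemma length_sent_mwis:
  assumes v: "v \<in> V" and j: "j < length (P v)" and M: "2 \<le> M" "card V \<le> M" and L: "1 \<le> L"
    and A: "\<And>i r j. i < t \<Longrightarrow> j < length (restrict_ports P (G i) v) \<Longrightarrow>
      real (length (sent A (view_at A (restrict_ports P (G i)) N (\<lambda>_. 0) (component \<omega> i) r v) j)) \<le> L"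
    and LM: "14 * log 2 M + 1 \<le> L"
  shows "real (length (sent (compose (mwis t A)) (real_view R v) j)) \<le> L + 1"
proof -
  have gsend: "real (length (stage_sent (mwis t A) (hist s v) (run (hist s) r v) j)) \<le> L" if "s < 4 * t" for s r
    using that
  proof (cases rule: stage_cases)
    case (1 i)
    then have "outcome s r v \<noteq> None" using out_weight_good v by blast
    then show ?thesis using L by (auto simp: stage_sent_def outcome_def)
  next
    case (2 i)
    then have "outcome s r v \<noteq> None" using out_weight_good v by blast
    then show ?thesis using L by (auto simp: stage_sent_def outcome_def)
  next
    case (3 i)
    then show ?thesis using sent_elect[OF 3(1) out_good_stage[OF 3(1)] v j, of r] A[OF 3(1), of _ r] L by auto
  next
    case (4 k)
    then have "outcome s r v \<noteq> None" using out_immediate(2)[OF out_join] by blast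
    then show ?thesis using L by (auto simp: stage_sent_def outcome_def)
  qed
  have gout: "real (length (out s v)) \<le> L" if "s < 4 * t" for s
    using that
  proof (cases rule: stage_cases)
    case (1 i)
    have "length (P v) \<le> M" using length_ports[OF v] card_mono[OF finite_V[OF graph] neighbours_subset[OF graph]] M(2)
      by (metis le_trans)
    then have "real (length (encode (W i v) (length (P v)))) \<le> 14 * log 2 M + 1"
      using W_bounds[OF v] D M(1) by (intro length_encode[of _ D]) auto
    then show ?thesis using out_weight[OF 1(1) v] 1(2) LM by simp
  next
    case (2 i)
    then show ?thesis using out_good_stage[OF 2(1) v] L by simp
  next
    case (3 i)
    then show ?thesis using length_out_elect[OF 3(1) out_good_stage[OF 3(1)] v] L by simp
  next
    case (4 k)
    then show ?thesis using out_immediate(1)[OF out_join[of k v]] L by simp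
  qed
  show ?thesis
  proof (cases rule: compose_sent_cases[OF v, of R j])
    case 1 then show ?thesis using L by simp
  next
    case (2 s) then show ?thesis using gout[of s] by (simp add: mwis_simps)
  next
    case (3 s r) then show ?thesis using gsend[of s r] by (simp add: mwis_simps)
  qed
qed

end

section \<open>Probability of success and bandwidth\<close>

lemma prob_bind_pmf_le:
  assumes "\<And>x. x \<in> set_pmf M \<Longrightarrow> measure_pmf.prob (f x) A \<le> p"
  shows "measure_pmf.prob (bind_pmf M f) A \<le> p"
proof -
  obtain x where "x \<in> set_pmf M" using set_pmf_not_empty[of M] by blast
  then have p: "0 \<le> p" using assms[of x] measure_nonneg[of "f x" A] by linarith
  have "emeasure (bind_pmf M f) A = (\<integral>\<^sup>+x. emeasure (f x) A \<partial>M)" by simp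
  also have "\<dots> \<le> (\<integral>\<^sup>+x. ennreal p \<partial>M)"
    using assms by (intro nn_integral_mono_AE) (auto simp: AE_measure_pmf_iff measure_pmf.emeasure_eq_measure
      intro: ennreal_leI)
  also have "\<dots> = ennreal p" by simp
  finally show ?thesis using p by (simp add: measure_pmf.emeasure_eq_measure)
qed

lemma Pi_pmf_map_dep:
  assumes "finite I"
  shows "Pi_pmf I d (\<lambda>x. map_pmf (q x) (\<rho> x))
    = map_pmf (\<lambda>h x. if x \<in> I then q x (h x) else d) (Pi_pmf I d' \<rho>)"
  using assms by (simp add: map_pmf_def Pi_pmf_bind[where d' = d'])

text \<open>Draws component \<open>i\<close> last, so that the other components can be fixed before
  it.\<close>

lemma mwis_seed_split:
  assumes "i < t"
  shows "mwis_seed t A = bind_pmf (Pi_pmf ({..<t} - {i}) 0 (\<lambda>_. rnd A))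
    (\<lambda>f. map_pmf (\<lambda>y. list_encode (map (f(i := y)) [0..<t])) (rnd A))"
proof -
  have "Pi_pmf {..<t} 0 (\<lambda>_. rnd A) = Pi_pmf (insert i ({..<t} - {i})) 0 (\<lambda>_. rnd A)"
    using assms by (simp add: insert_absorb)
  also have "\<dots> = bind_pmf (Pi_pmf ({..<t} - {i}) 0 (\<lambda>_. rnd A)) (\<lambda>f. map_pmf (\<lambda>y. f(i := y)) (rnd A))"
    by (subst Pi_pmf_insert', simp, simp, subst bind_commute_pmf) (simp add: map_pmf_def)
  finally show ?thesis
    by (simp add: mwis_seed_def map_bind_pmf map_pmf_comp o_def)
qed

text \<open>Phase \<open>i\<close> uses only the \<open>i\<close>-th components of the seeds, which are independent of the other
  components, while the subnetwork \<open>F\<close> it runs on is determined by the components before \<open>i\<close>.\<close>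
lemma prob_component_le:
  fixes F :: "(nat \<Rightarrow> nat \<times> nat \<Rightarrow> nat) \<Rightarrow> 'b"
  assumes I: "finite I" "I' \<subseteq> I" and i: "i < t"
    and F: "\<And>\<sigma> \<sigma>'. (\<And>j. j < i \<Longrightarrow> \<sigma> j = \<sigma>' j) \<Longrightarrow> F \<sigma> = F \<sigma>'"
    and local: "\<And>b \<sigma> \<sigma>'. (\<And>x. x \<in> I' \<Longrightarrow> \<sigma> x = \<sigma>' x) \<Longrightarrow> \<sigma> \<in> Ev b \<Longrightarrow> \<sigma>' \<in> Ev b"
    and prob: "\<And>\<sigma>. measure_pmf.prob (Pi_pmf I' 0 (\<lambda>_. rnd A)) (Ev (F \<sigma>)) \<ge> 1 - p"
  shows "measure_pmf.prob (Pi_pmf I 0 (\<lambda>_. mwis_seed t A)) {\<omega>. component \<omega> i \<notin> Ev (F (component \<omega>))} \<le> p"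
proof -
  let ?\<Pi> = "Pi_pmf I 0 (\<lambda>_. rnd A)"
  \<comment> \<open>\<open>m g h\<close> assembles the seeds of the protocol from the other
    components \<open>g\<close> and the component \<open>h\<close> of phase
    \<open>i\<close>.\<close>
  define m where "m g h x = (if x \<in> I then list_encode (map ((g x)(i := h x)) [0..<t]) else 0)"
    for g :: "nat \<times> nat \<Rightarrow> nat \<Rightarrow> nat" and h x
  have "Pi_pmf I 0 (\<lambda>_. mwis_seed t A) =
      bind_pmf (Pi_pmf I (\<lambda>_. 0) (\<lambda>_. Pi_pmf ({..<t} - {i}) 0 (\<lambda>_. rnd A))) (\<lambda>g. map_pmf (m g) ?\<Pi>)"
    unfolding mwis_seed_split[OF i] Pi_pmf_bind[OF I(1), where d' = "\<lambda>_. 0"]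
    using I(1) by (subst Pi_pmf_map_dep[where d' = 0]) (simp_all add: m_def[abs_def])
  moreover have "measure_pmf.prob (map_pmf (m g) ?\<Pi>) {\<omega>. component \<omega> i \<notin> Ev (F (component \<omega>))} \<le> p" for g
  proof -
    \<comment> \<open>With \<open>g\<close> fixed the instance is fixed as well: \<open>F\<close>
      reads only components before \<open>i\<close>, so 0 may stand in for \<open>h\<close>.\<close>
    let ?b = "F (component (m g (\<lambda>_. 0)))"
    let ?r = "\<lambda>h x. if x \<in> I' then h x else (0::nat)"
    have "component (m g h) i \<in> Ev (F (component (m g h))) \<longleftrightarrow> ?r h \<in> Ev ?b" for h
    proof -
      have "F (component (m g h)) = ?b"
      proof (rule F)
        fix j assume "j < i"
        then show "component (m g h) j = component (m g (\<lambda>_. 0)) j"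
          using i by (auto simp: fun_eq_iff component_def m_def)
      qed
      moreover have "component (m g h) i x = ?r h x" if "x \<in> I'" for x
        using that I(2) i by (auto simp: component_def m_def)
      ultimately show ?thesis
        using local[of "component (m g h) i" "?r h"] local[of "?r h" "component (m g h) i"] by auto
    qed
    then have "measure_pmf.prob (map_pmf (m g) ?\<Pi>) {\<omega>. component \<omega> i \<notin> Ev (F (component \<omega>))}
        = measure_pmf.prob (map_pmf ?r ?\<Pi>) (- Ev ?b)"
      unfolding measure_map_pmf by (intro arg_cong[where f = "measure_pmf.prob ?\<Pi>"]) auto
    also have "\<dots> = measure_pmf.prob (Pi_pmf I' 0 (\<lambda>_. rnd A)) (- Ev ?b)"
      using Pi_pmf_subset[OF I, of 0 "\<lambda>_. rnd A"] by simp
    also have "\<dots> \<le> p" using prob[of "component (m g (\<lambda>_. 0))"]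
      by (simp add: measure_pmf.prob_compl[of "Ev ?b", simplified] Compl_eq_Diff_UNIV)
    finally show ?thesis .
  qed
  ultimately show ?thesis by (simp add: prob_bind_pmf_le)
qed

lemma view_at_cong:
  assumes P: "\<And>v. v \<in> V \<Longrightarrow> set (P v) \<subseteq> V"
    and eq: "\<And>v k. v \<in> V \<Longrightarrow> k \<le> r \<Longrightarrow> \<omega> (v, k) = \<omega>' (v, k)" and v: "v \<in> V"
  shows "view_at A P N w \<omega> r v = view_at A P N w \<omega>' r v"
  using v eq
proof (induction r arbitrary: v)
  case (Suc r)
  have IH: "view_at A P N w \<omega> r u = view_at A P N w \<omega>' r u" if "u \<in> V" for u
    using that Suc.prems(2) by (intro Suc.IH) auto
  have "map (\<lambda>u. sent A (view_at A P N w \<omega> r u) (port_to P u v)) (P v) =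
      map (\<lambda>u. sent A (view_at A P N w \<omega>' r u) (port_to P u v)) (P v)"
    using IH P[OF Suc.prems(1)] by (intro map_cong) (auto simp: subset_iff)
  then show ?case using IH[OF Suc.prems(1)] Suc.prems by (simp add: Let_def)
qed simp

lemma finishes_cong:
  assumes P: "\<And>v. v \<in> V \<Longrightarrow> set (P v) \<subseteq> V" and eq: "\<And>x. x \<in> V \<times> {..r} \<Longrightarrow> \<omega> x = \<omega>' x"
    and fin: "finishes A V P N w r Q \<omega>"
  shows "finishes A V P N w r Q \<omega>'"
proof -
  have v: "view_at A P N w \<omega>' r v = view_at A P N w \<omega> r v" if "v \<in> V" for v
    using eq by (intro view_at_cong[OF P _ that]) auto
  then have "{v\<in>V. result A (view_at A P N w \<omega>' r v) = Some True} =
    {v\<in>V. result A (view_at A P N w \<omega> r v) = Some True}" by auto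
  then show ?thesis using fin v by (simp add: finishes_def)
qed

lemma neighbours_restrict_edges: "neighbours (restrict_edges E S) v = {u\<in>neighbours E v. v \<in> S \<and> u \<in> S}"
  by (auto simp: neighbours_def restrict_edges_def)

lemma congest_network_restrict:
  assumes "congest_network a b V E P N"
  shows "congest_network a b V (restrict_edges E S) (restrict_ports P S) N"
  using assms unfolding congest_network_def simple_graph_def port_numbering_def neighbours_restrict_edges
  by (auto simp: restrict_edges_def restrict_ports_def)

text \<open>Lets the running time be taken at the original maximum degree, since
  \<open>MIS_algorithm\<close> admits every upper bound on the degree.\<close>

lemma max_degree_restrict:
  assumes "simple_graph V E"
  shows "max_degree V (restrict_edges E S) \<le> max_degree V E"
proof -
  have "card (neighbours (restrict_edges E S) v) \<le> max_degree V E" if "v \<in> V" for v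
  proof -
    have "card (neighbours (restrict_edges E S) v) \<le> card (neighbours E v)"
      unfolding neighbours_restrict_edges by (intro card_mono finite_neighbours[OF assms]) auto
    then show ?thesis using degree_le_max[OF assms that] by simp
  qed
  moreover have "V \<noteq> {}" using assms by (simp add: simple_graph_def)
  ultimately show ?thesis using finite_V[OF assms] by (simp add: max_degree_def[of V "restrict_edges E S"])
qed

lemma component_in_support:
  assumes "\<omega> x \<in> set_pmf (mwis_seed t A)" "i < t"
  shows "component \<omega> i x \<in> set_pmf (rnd A)"
proof -
  obtain f where f: "\<omega> x = list_encode (map f [0..<t])" "f \<in> set_pmf (Pi_pmf {..<t} 0 (\<lambda>_. rnd A))"
    using assms(1) by (auto simp: mwis_seed_def)
  then have "f i \<in> set_pmf (rnd A)" using assms(2) by (auto simp: set_Pi_pmf PiE_dflt_def)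
  then show ?thesis using f(1) assms(2) by (simp add: component_def)
qed

text \<open>Makes \<open>log 2 (card V)\<close> at least 1, so that additive constants in message
  lengths can be absorbed.\<close>

lemma two_le_card:
  assumes "simple_graph V E" "1 \<le> max_degree V E"
  shows "2 \<le> card V"
proof -
  have "max_degree V E \<in> (\<lambda>v. card (neighbours E v)) ` V"
    unfolding max_degree_def using assms by (intro Max_in) (auto simp: simple_graph_def)
  then obtain v where v: "v \<in> V" "1 \<le> card (neighbours E v)" using assms(2) by auto
  then obtain u where u: "u \<in> neighbours E v" by fastforce
  have "{u, v} \<subseteq> V" "u \<noteq> v" using u v neighbour_in[OF assms(1)] not_own_neighbour[OF assms(1)] by auto
  then show ?thesis using card_mono[OF finite_V[OF assms(1)], of "{u, v}"] by simp
qed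

section \<open>Bandwidth and success probability in a given network\<close>

locale mwis_reduction =
  fixes a b d :: nat and \<beta> :: real and T :: "nat \<Rightarrow> nat \<Rightarrow> nat" and p :: "nat \<Rightarrow> real" and A :: algo
    and V :: "nat set" and E :: "nat set set" and P :: "nat \<Rightarrow> nat list" and N :: nat and w :: "nat \<Rightarrow> real"
  assumes MIS: "MIS_algorithm a b \<beta> T p A" and T_pos: "\<And>n \<Delta>. 1 \<le> T n \<Delta>"
    and network: "congest_network a b V E P N" and weights: "poly_weights d V w"
    and deg: "1 \<le> max_degree V E"
begin

lemma graph: "simple_graph V E" and ports: "port_numbering V E P"
  using network by (auto simp: congest_network_def)

text \<open>The exponent is \<open>d + 1\<close> because this number later has to bound the degrees
  too, even for \<open>d = 0\<close>.\<close>

lemma mwis_run_ex: "\<exists>D. mwis_run V E P w D (card V ^ (d + 1))"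
proof -
  obtain D where D: "1 \<le> D" "D \<le> card V ^ d" "\<And>v. v \<in> V \<Longrightarrow> \<bar>w v\<bar> \<le> real (card V) ^ d \<and> w v * real D \<in> \<int>"
    using weights by (auto simp: poly_weights_def)
  have n: "1 \<le> card V" using two_le_card[OF graph deg] by simp
  have "card V ^ d \<le> card V ^ (d + 1)" using n by (intro power_increasing) auto
  moreover have "real (card V) ^ d \<le> real (card V) ^ (d + 1)" using n by (intro power_increasing) auto
  ultimately have "mwis_run V E P w D (card V ^ (d + 1))"
    using D graph ports by unfold_locales (auto intro: order_trans)
  then show ?thesis ..
qed

text \<open>Encoded weights cost \<open>14 * (real d + 1)\<close> because \<open>M\<close> is
  \<open>card V ^ (d + 1)\<close>; the final 2 covers their additive bit and the tag bit. The
  absolute value allows for negative \<beta>.\<close>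

lemma bandwidth_mwis: "bandwidth (compose (mwis t A)) V P N w (\<bar>\<beta>\<bar> + 14 * (real d + 1) + 2)"
  unfolding bandwidth_def
proof (intro allI impI ballI)
  fix \<omega> :: "nat \<times> nat \<Rightarrow> nat" and r v i
  assume \<omega>: "\<forall>x. \<omega> x \<in> set_pmf (rnd (compose (mwis t A)))" and v: "v \<in> V" and i: "i < length (P v)"
  obtain D where "mwis_run V E P w D (card V ^ (d + 1))" using mwis_run_ex ..
  then interpret mwis_run A t V E P N w \<omega> D "card V ^ (d + 1)" .
  have n: "2 \<le> card V" using two_le_card[OF graph deg] .
  have nM: "card V \<le> card V ^ (d + 1)" using n by (intro self_le_power) auto
  have log: "1 \<le> log 2 (card V)" using n by simp
  define L where "L = (\<bar>\<beta>\<bar> + 14 * (real d + 1) + 1) * log 2 (card V)"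
  have "real (length (sent (compose (mwis t A)) (real_view r v) i)) \<le> L + 1"
  proof (rule length_sent_mwis[OF v i _ nM])
    show "2 \<le> card V ^ (d + 1)" using n nM by (rule le_trans)
    have "1 * log 2 (card V) \<le> L" unfolding L_def using log by (intro mult_right_mono) auto
    then show "1 \<le> L" using log by simp
    have "14 * log 2 (real (card V ^ (d + 1))) + 1 \<le> 14 * (real d + 1) * log 2 (card V) + log 2 (card V)"
    proof -
      have log_M: "log 2 (real (card V ^ (d + 1))) = real (d + 1) * log 2 (card V)"
        unfolding of_nat_power using n by (intro log_nat_power) simp
      then show ?thesis using log unfolding log_M by (simp add: algebra_simps)
    qed
    also have "\<dots> \<le> L" unfolding L_def using log by (simp add: distrib_right)
    finally show "14 * log 2 (real (card V ^ (d + 1))) + 1 \<le> L" .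
  next
    fix i r j assume "i < t" and j: "j < length (restrict_ports P (G i) v)"
    then have "\<forall>x. component \<omega> i x \<in> set_pmf (rnd A)"
      using \<omega> component_in_support[of \<omega> _ t A i] by (simp add: compose_def mwis_def del: split_paired_All)
    moreover have "bandwidth A V (restrict_ports P (G i)) N (\<lambda>_. 0) \<beta>"
      using MIS congest_network_restrict[OF network] unfolding MIS_algorithm_def by blast
    ultimately have "real (length (sent A (view_at A (restrict_ports P (G i)) N (\<lambda>_. 0) (component \<omega> i) r v) j))
        \<le> \<beta> * log 2 (card V)" using v j by (simp add: bandwidth_def)
    also have "\<dots> \<le> L" unfolding L_def using log by (intro mult_right_mono) auto
    finally show "real (length (sent A (view_at A (restrict_ports P (G i)) N (\<lambda>_. 0) (component \<omega> i) r v) j)) \<le> L" .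
  qed
  also have "\<dots> \<le> (\<bar>\<beta>\<bar> + 14 * (real d + 1) + 2) * log 2 (card V)"
    unfolding L_def using log by (simp add: algebra_simps)
  finally show "real (length (sent (compose (mwis t A)) (view_at (compose (mwis t A)) P N w \<omega> r v) i))
      \<le> (\<bar>\<beta>\<bar> + 14 * (real d + 1) + 2) * log 2 (card V)" .
qed

lemma success_prob_mwis:
  assumes eps: "0 < \<epsilon>" and t: "6 / \<epsilon> \<le> real t" and R: "4 * t * Suc (T (card V) (max_degree V E)) \<le> R"
  shows "success_prob (compose (mwis t A)) V P N w R (approximates_MWIS V E w ((1 + \<epsilon>) * real (max_degree V E)))
    \<ge> 1 - real t * p (card V)"
proof -
  let ?T = "T (card V) (max_degree V E)" and ?\<Pi> = "Pi_pmf (V \<times> {..R}) 0 (\<lambda>_. mwis_seed t A)"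
  let ?F = "\<lambda>i \<sigma>. good V E (residual A V E P N w \<sigma> i)"
  let ?Ev = "\<lambda>S. {\<sigma>. finishes A V (restrict_ports P S) N (\<lambda>_. 0) ?T (maximal_independent_set V (restrict_edges E S)) \<sigma>}"
  let ?Bad = "\<lambda>i. {\<omega>. component \<omega> i \<notin> ?Ev (?F i (component \<omega>))}"
  obtain D where D: "mwis_run V E P w D (card V ^ (d + 1))" using mwis_run_ex ..
  have fin: "finite (V \<times> {..R})" using finite_V[OF graph] by simp
  have P_in: "set (restrict_ports P S v) \<subseteq> V" if "v \<in> V" for S v
    using that ports neighbour_in[OF graph] by (auto simp: restrict_ports_def port_numbering_def)
  \<comment> \<open>With at least one phase, \<open>R\<close> is at least the running time of the
    black box, so all its seeds are among those drawn.\<close>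
  have "t \<noteq> 0"
  proof
    assume "t = 0"
    then have "6 / \<epsilon> \<le> 0" using t by simp
    then show False using eps by (simp add: divide_le_0_iff)
  qed
  then have "1 * ?T \<le> 4 * t * Suc ?T" by (intro mult_le_mono) auto
  then have TR: "?T \<le> R" using R by simp
  have bad: "measure_pmf.prob ?\<Pi> (?Bad i) \<le> p (card V)" if "i < t" for i
  proof (rule prob_component_le[OF fin _ that, where I' = "V \<times> {..?T}" and F = "?F i" and Ev = ?Ev])
    show "V \<times> {..?T} \<subseteq> V \<times> {..R}" using TR by auto
    show "?F i \<sigma> = ?F i \<sigma>'" if "\<And>j. j < i \<Longrightarrow> \<sigma> j = \<sigma>' j" for \<sigma> \<sigma>'
      using residual_cong[of i \<sigma> \<sigma>'] that by simp
    show "\<sigma>' \<in> ?Ev S" if "\<And>x. x \<in> V \<times> {..?T} \<Longrightarrow> \<sigma> x = \<sigma>' x" "\<sigma> \<in> ?Ev S" for S \<sigma> \<sigma>'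
      using finishes_cong[OF P_in that(1)] that(2) by simp
    show "1 - p (card V) \<le> measure_pmf.prob (Pi_pmf (V \<times> {..?T}) 0 (\<lambda>_. rnd A)) (?Ev (?F i \<sigma>))" for \<sigma>
    proof -
      let ?S = "?F i \<sigma>"
      from MIS congest_network_restrict[OF network, of ?S]
      have "\<forall>\<Delta>\<ge>max_degree V (restrict_edges E ?S). success_prob A V (restrict_ports P ?S) N (\<lambda>_. 0) (T (card V) \<Delta>)
          (maximal_independent_set V (restrict_edges E ?S)) \<ge> 1 - p (card V)"
        unfolding MIS_algorithm_def by blast
      from this[rule_format, OF max_degree_restrict[OF graph]]
      show ?thesis unfolding success_prob_def .
    qed
  qed
  \<comment> \<open>Union bound over the phases; outside the bad events every election succeeds and
    \<open>finishes_mwis\<close> applies.\<close>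
  have "measure_pmf.prob ?\<Pi> (\<Union>i\<in>{..<t}. ?Bad i) \<le> (\<Sum>i\<in>{..<t}. measure_pmf.prob ?\<Pi> (?Bad i))"
    by (intro measure_pmf.finite_measure_subadditive_finite) auto
  also have "\<dots> \<le> (\<Sum>i\<in>{..<t}. p (card V))" using bad by (intro sum_mono) auto
  finally have "measure_pmf.prob ?\<Pi> (\<Union>i\<in>{..<t}. ?Bad i) \<le> real t * p (card V)" by simp
  then have "1 - real t * p (card V) \<le> measure_pmf.prob ?\<Pi> (UNIV - (\<Union>i\<in>{..<t}. ?Bad i))"
    using measure_pmf.prob_compl[of "\<Union>i\<in>{..<t}. ?Bad i" ?\<Pi>] by simp
  also have "\<dots> \<le> measure_pmf.prob ?\<Pi> {\<omega>. finishes (compose (mwis t A)) V P N w R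
      (approximates_MWIS V E w ((1 + \<epsilon>) * real (max_degree V E))) \<omega>}"
  proof (rule measure_pmf.finite_measure_mono)
    show "UNIV - (\<Union>i\<in>{..<t}. ?Bad i) \<subseteq> {\<omega>. finishes (compose (mwis t A)) V P N w R
      (approximates_MWIS V E w ((1 + \<epsilon>) * real (max_degree V E))) \<omega>}"
    proof (intro subsetI CollectI mwis_run.finishes_mwis[OF D deg eps t _ R])
      fix \<omega> i assume "\<omega> \<in> UNIV - (\<Union>i\<in>{..<t}. ?Bad i)" "i < t"
      then have "\<omega> \<notin> ?Bad i" by blast
      then show "finishes A V (restrict_ports P (?F i (component \<omega>))) N (\<lambda>_. 0) ?T
          (maximal_independent_set V (restrict_edges E (?F i (component \<omega>)))) (component \<omega> i)" by simp
    qed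
  qed simp
  finally show ?thesis by (simp add: success_prob_def compose_def mwis_def)
qed

end

theorem theorem1:
  "\<exists>C>0. \<forall>(a::nat) (b::nat) (d::nat) (\<beta>::real) (T::nat \<Rightarrow> nat \<Rightarrow> nat) (p::nat \<Rightarrow> real) (A::algo).
     MIS_algorithm a b \<beta> T p A \<and> (\<forall>n \<Delta>. T n \<Delta> \<ge> 1) \<longrightarrow>
     (\<exists>\<beta>'. \<forall>\<epsilon>>0. \<exists>B.
        MWIS_algorithm a b d \<beta>'
          (\<lambda>\<Delta>. (1 + \<epsilon>) * real \<Delta>)
          (\<lambda>n \<Delta>. C * real (T n \<Delta>) * max 1 (1 / \<epsilon>))
          (\<lambda>n. C * p n * max 1 (1 / \<epsilon>)) B \<and>
        (deterministic A \<longrightarrow> deterministic B))"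
proof (rule exI[of _ 56], intro conjI allI impI)
  fix a b d :: nat and \<beta> :: real and T :: "nat \<Rightarrow> nat \<Rightarrow> nat" and p :: "nat \<Rightarrow> real" and A :: algo
  assume asm: "MIS_algorithm a b \<beta> T p A \<and> (\<forall>n \<Delta>. T n \<Delta> \<ge> 1)"
  show "\<exists>\<beta>'. \<forall>\<epsilon>>0. \<exists>B.
        MWIS_algorithm a b d \<beta>' (\<lambda>\<Delta>. (1 + \<epsilon>) * real \<Delta>)
          (\<lambda>n \<Delta>. 56 * real (T n \<Delta>) * max 1 (1 / \<epsilon>)) (\<lambda>n. 56 * p n * max 1 (1 / \<epsilon>)) B \<and>
        (deterministic A \<longrightarrow> deterministic B)"
  proof (intro exI[of _ "\<bar>\<beta>\<bar> + 14 * (real d + 1) + 2"] allI impI)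
    fix \<epsilon> :: real assume eps: "0 < \<epsilon>"
    define t where "t = nat \<lceil>6 / \<epsilon>\<rceil>"
    have t: "6 / \<epsilon> \<le> real t" unfolding t_def by linarith
    have "real t \<le> 6 / \<epsilon> + 1" unfolding t_def using eps by (simp add: of_nat_ceiling)
    moreover have "6 / \<epsilon> \<le> 6 * max 1 (1 / \<epsilon>)" by (simp add: max_def)
    ultimately have t_le: "real t \<le> 7 * max 1 (1 / \<epsilon>)" by linarith
    have "MWIS_algorithm a b d (\<bar>\<beta>\<bar> + 14 * (real d + 1) + 2) (\<lambda>\<Delta>. (1 + \<epsilon>) * real \<Delta>)
          (\<lambda>n \<Delta>. 56 * real (T n \<Delta>) * max 1 (1 / \<epsilon>)) (\<lambda>n. 56 * p n * max 1 (1 / \<epsilon>)) (compose (mwis t A))"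
      unfolding MWIS_algorithm_def
    proof (intro allI impI)
      fix V E P N w
      assume net: "congest_network a b V E P N \<and> poly_weights d V w \<and> max_degree V E \<ge> 1"
      interpret mwis_reduction a b d \<beta> T p A V E P N w
        using asm net by unfold_locales auto
      let ?T = "T (card V) (max_degree V E)"
      \<comment> \<open>The constant 56 is 4 times 7 times 2: four stages per phase including its
        unwinding, at most \<open>7 * max 1 (1 / \<epsilon>)\<close> phases, and
        \<open>Suc ?T\<close> at most twice \<open>?T\<close>.\<close>
      have "real (4 * t * Suc ?T) \<le> 4 * (7 * max 1 (1 / \<epsilon>)) * (2 * real ?T)"
        unfolding of_nat_mult using t_le T_pos[of "card V" "max_degree V E"] by (intro mult_mono) auto
      then have R: "4 * t * Suc ?T \<le> nat \<lfloor>56 * real ?T * max 1 (1 / \<epsilon>)\<rfloor>"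
        by (simp add: le_nat_floor algebra_simps)
      \<comment> \<open>A probability is at most 1, so \<open>p (card V)\<close> is nonnegative and
        the factor 7 may be raised to 56.\<close>
      have "1 - p (card V) \<le> success_prob A V P N (\<lambda>_. 0) ?T (maximal_independent_set V E)"
        using MIS network by (simp add: MIS_algorithm_def)
      also have "\<dots> \<le> 1" unfolding success_prob_def by simp
      finally have p: "1 - p (card V) \<le> 1" .
      then have "real t * p (card V) \<le> 7 * max 1 (1 / \<epsilon>) * p (card V)"
        using t_le by (intro mult_right_mono) auto
      also have "\<dots> \<le> 56 * max 1 (1 / \<epsilon>) * p (card V)"
        using p by (intro mult_right_mono) auto
      finally have "real t * p (card V) \<le> 56 * p (card V) * max 1 (1 / \<epsilon>)" by (simp add: ac_simps)
      then show "bandwidth (compose (mwis t A)) V P N w (\<bar>\<beta>\<bar> + 14 * (real d + 1) + 2) \<and>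
        success_prob (compose (mwis t A)) V P N w (nat \<lfloor>56 * real ?T * max 1 (1 / \<epsilon>)\<rfloor>)
            (approximates_MWIS V E w ((1 + \<epsilon>) * real (max_degree V E)))
          \<ge> 1 - 56 * p (card V) * max 1 (1 / \<epsilon>)"
        using bandwidth_mwis[of t] success_prob_mwis[OF eps t R] by auto
    qed
    moreover have "deterministic (compose (mwis t A))" if "deterministic A"
      using that by (auto simp: deterministic_def compose_def mwis_def mwis_seed_def)
    ultimately show "\<exists>B. MWIS_algorithm a b d (\<bar>\<beta>\<bar> + 14 * (real d + 1) + 2) (\<lambda>\<Delta>. (1 + \<epsilon>) * real \<Delta>)
          (\<lambda>n \<Delta>. 56 * real (T n \<Delta>) * max 1 (1 / \<epsilon>)) (\<lambda>n. 56 * p n * max 1 (1 / \<epsilon>)) B \<and>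
        (deterministic A \<longrightarrow> deterministic B)" by blast
  qed
qed simp

end
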